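(* For every $n\ge1$ and every $j\ge1$, \[\Gamma_j(IA_n^+)=\Gamma_j(IA_n)\cap IA_n^+=\mathcal A_j\cap IA_n^+.\]
   Context: $F_n$ is free on the ordered basis $(x_1,\dots,x_n)$, $F_{i-1}=\langle x_1,\dots,x_{i-1}\rangle$, $x^y=y^{-1}xy$, $[x,y]=xyx^{-1}y^{-1}$, and $\Gamma_*$ is the lower central series ($\Gamma_1(G)=G$, $\Gamma_{k+1}(G)=[G,\Gamma_k(G)]$). $IA_n$ is the group of automorphisms of $F_n$ acting trivially on $F_n^{ab}$. The Andreadakis filtration: $\mathcal A_j$ is the subgroup of automorphisms $\sigma$ of $F_n$ with $\sigma(x)x^{-1}\in\Gamma_{j+1}(F_n)$ for all $x\in F_n$. $IA_n^+$ (triangular automorphisms) is the group of automorphisms $\varphi$ of $F_n$ such that for each $i$, $\varphi(x_i)=x_i^{w_i}\gamma_i$ with $w_i\in F_{i-1}$ and $\gamma_i\in\Gamma_2(F_{i-1})$. *)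

theory Defs
  imports "HOL-Algebra.Algebra"
begin

text \<open>Letters: (i, True) is the generator x_i, (i, False) its inverse.
  Elements of F_n are freely reduced words in letters with index < n.\<close>

type_synonym letter = "nat \<times> bool"

definition inverse_letters :: "letter \<Rightarrow> letter \<Rightarrow> bool" where
  "inverse_letters a b \<longleftrightarrow> fst a = fst b \<and> snd a \<noteq> snd b"

fun reduced :: "letter list \<Rightarrow> bool" where
  "reduced [] = True"
| "reduced [a] = True"
| "reduced (a # b # w) = (\<not> inverse_letters a b \<and> reduced (b # w))"

fun cancel_cons :: "letter \<Rightarrow> letter list \<Rightarrow> letter list" where
  "cancel_cons a [] = [a]"
| "cancel_cons a (b # w) = (if inverse_letters a b then w else a # b # w)"

definition reduce :: "letter list \<Rightarrow> letter list" where
  "reduce w = foldr cancel_cons w []"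

definition free_group :: "nat \<Rightarrow> letter list monoid" where
  "free_group n =
     \<lparr>carrier = {w. reduced w \<and> (\<forall>a\<in>set w. fst a < n)},
      monoid.mult = (\<lambda>u v. reduce (u @ v)),
      one = []\<rparr>"

definition gen :: "nat \<Rightarrow> letter list" where
  "gen i = [(i, True)]"

definition initial_subgroup :: "nat \<Rightarrow> nat \<Rightarrow> letter list set" where
  "initial_subgroup n k = generate (free_group n) (gen ` {i. i < k})"

text \<open>Commutator [x,y] = x y x^-1 y^-1. Gamma_1 = G, Gamma_(k+1) = [G, Gamma_k].
  Indexing: lower_central G j = Gamma_j(G) for j \<ge> 1 (index 0 also gives G).\<close>

fun lower_central :: "('a, 'b) monoid_scheme \<Rightarrow> nat \<Rightarrow> 'a set" where
  "lower_central G 0 = carrier G"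
| "lower_central G (Suc 0) = carrier G"
| "lower_central G (Suc (Suc k)) =
     generate G (\<Union>g\<in>carrier G. \<Union>h\<in>lower_central G (Suc k).
        {g \<otimes>\<^bsub>G\<^esub> h \<otimes>\<^bsub>G\<^esub> inv\<^bsub>G\<^esub> g \<otimes>\<^bsub>G\<^esub> inv\<^bsub>G\<^esub> h})"

abbreviation AutF :: "nat \<Rightarrow> (letter list \<Rightarrow> letter list) monoid" where
  "AutF n \<equiv> AutoGroup (free_group n)"

definition andreadakis :: "nat \<Rightarrow> nat \<Rightarrow> (letter list \<Rightarrow> letter list) set" where
  "andreadakis n j = {\<sigma> \<in> auto (free_group n).
     \<forall>x \<in> carrier (free_group n).
       \<sigma> x \<otimes>\<^bsub>free_group n\<^esub> inv\<^bsub>free_group n\<^esub> x \<in> lower_central (free_group n) (Suc j)}"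

text \<open>IA_n: automorphisms acting trivially on F_n^ab = F_n / Gamma_2(F_n).\<close>
definition IA :: "nat \<Rightarrow> (letter list \<Rightarrow> letter list) set" where
  "IA n = {\<sigma> \<in> auto (free_group n).
     \<forall>x \<in> carrier (free_group n).
       \<sigma> x \<otimes>\<^bsub>free_group n\<^esub> inv\<^bsub>free_group n\<^esub> x \<in> lower_central (free_group n) 2}"

text \<open>Triangular automorphisms IA_n^+: phi(x_i) = x_i^(w_i) gamma_i with
  w_i in F_(i-1), gamma_i in Gamma_2(F_(i-1)); x^y = y^-1 x y.
  (0-based: generator x_k with w, gamma in the subgroup generated by x_0..x_(k-1).)\<close>
definition IA_plus :: "nat \<Rightarrow> (letter list \<Rightarrow> letter list) set" where
  "IA_plus n = {\<phi> \<in> auto (free_group n). \<forall>k < n.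
     \<exists>w \<in> initial_subgroup n k.
     \<exists>\<gamma> \<in> lower_central ((free_group n)\<lparr>carrier := initial_subgroup n k\<rparr>) 2.
       \<phi> (gen k) = inv\<^bsub>free_group n\<^esub> w \<otimes>\<^bsub>free_group n\<^esub> gen k \<otimes>\<^bsub>free_group n\<^esub> w
                     \<otimes>\<^bsub>free_group n\<^esub> \<gamma>}"

end

theory Submission
  imports Defs "HOL-Library.Function_Algebras" "HOL-Library.Nat_Bijection"
begin

text \<open>
  Write \<open>\<Gamma>\<^sub>j\<close> for the lower central series and \<open>F\<^sub>i\<close> for the free group on the generators of index below \<open>i\<close>.
  Only \<open>\<A>\<^sub>j \<inter> IA\<^sub>n\<^sup>+ \<subseteq> \<Gamma>\<^sub>j(IA\<^sub>n\<^sup>+)\<close> is hard. A triangular automorphism in \<open>\<A>\<^sub>j\<close> is a product of triangular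
  automorphisms in \<open>\<A>\<^sub>j\<close> that move a single generator, \<open>x\<^sub>i \<mapsto> w\<inverse> x\<^sub>i w \<gamma>\<close> with \<open>w, \<gamma> \<in> F\<^sub>i\<close>. Sending \<open>x\<^sub>i\<close> to \<open>1\<close>
  gives \<open>\<gamma> \<in> \<Gamma>\<^sub>j\<^sub>+\<^sub>1(F\<^sub>i)\<close>, hence \<open>[w\<inverse>, x\<^sub>i] \<in> \<Gamma>\<^sub>j\<^sub>+\<^sub>1(F\<^sub>n)\<close>, and this forces \<open>w \<in> \<Gamma>\<^sub>j(F\<^sub>i)\<close>. Conversely
  \<open>c\<^sub>w : x\<^sub>i \<mapsto> w\<inverse> x\<^sub>i w\<close> is a homomorphism in \<open>w\<close>, and \<open>e\<^sub>\<gamma> : x\<^sub>i \<mapsto> x\<^sub>i \<gamma>\<close> satisfies \<open>[c\<^sub>w, e\<^sub>\<gamma>] = e\<^sub>[\<^sub>w\<^sub>,\<^sub>\<gamma>\<^sub>]\<close>, so both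
  lie in \<open>\<Gamma>\<^sub>j(IA\<^sub>n\<^sup>+)\<close>.

  The step from \<open>[w, x\<^sub>i]\<close> to \<open>w\<close> rests on Magnus' theorem: a word whose Magnus expansion is \<open>1\<close> up to
  terms of weight at least \<open>k\<close> lies in \<open>\<Gamma>\<^sub>k\<close>. It is proved for weighted letters by Lazard elimination: modulo
  \<open>\<Gamma>\<^sub>k\<close> a word equals \<open>u t\<^sup>a\<close>, where \<open>u\<close> is a word in the commutators \<open>x\<^sub>m = [t, [t, \<dots>, [t, x]]]\<close>. The group
  acts on power series in the new letters \<open>x\<^sub>m\<close>, with \<open>x\<close> acting by left multiplication by \<open>1 + X\<^sub>0\<close> and \<open>t\<close> by the
  automorphism \<open>1 + X\<^sub>m \<mapsto> (1 + X\<^sub>m\<^sub>+\<^sub>1) (1 + X\<^sub>m)\<close>, which fixes \<open>1\<close>. Evaluating at \<open>1\<close> recovers the expansion of \<open>u\<close>,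
  and the number of letters of smallest weight has dropped.
\<close>


section \<open>Strongly central filtrations\<close>

definition commutator :: "('a, 'b) monoid_scheme \<Rightarrow> 'a \<Rightarrow> 'a \<Rightarrow> 'a" where
  "commutator G x y = x \<otimes>\<^bsub>G\<^esub> y \<otimes>\<^bsub>G\<^esub> inv\<^bsub>G\<^esub> x \<otimes>\<^bsub>G\<^esub> inv\<^bsub>G\<^esub> y"

context group
begin

lemma inv_mult_cancel:
  "x \<in> carrier G \<Longrightarrow> y \<in> carrier G \<Longrightarrow> inv x \<otimes> (x \<otimes> y) = y"
  "x \<in> carrier G \<Longrightarrow> y \<in> carrier G \<Longrightarrow> x \<otimes> (inv x \<otimes> y) = y"
  by (simp_all add: m_assoc[symmetric])

lemmas word_simps = m_assoc inv_mult_group inv_mult_cancel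

lemma commutator_closed [simp]:
  "x \<in> carrier G \<Longrightarrow> y \<in> carrier G \<Longrightarrow> commutator G x y \<in> carrier G"
  by (simp add: commutator_def)

lemma inv_commutator:
  "x \<in> carrier G \<Longrightarrow> y \<in> carrier G \<Longrightarrow> inv (commutator G x y) = commutator G y x"
  by (simp add: commutator_def word_simps)

lemma commutator_mult_left:
  "\<lbrakk>x \<in> carrier G; y \<in> carrier G; z \<in> carrier G\<rbrakk> \<Longrightarrow>
    commutator G (x \<otimes> y) z = x \<otimes> commutator G y z \<otimes> inv x \<otimes> commutator G x z"
  by (simp add: commutator_def word_simps)

lemma commutator_inv_left:
  "\<lbrakk>x \<in> carrier G; z \<in> carrier G\<rbrakk> \<Longrightarrow>
    commutator G (inv x) z = inv x \<otimes> inv (commutator G x z) \<otimes> x"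
  by (simp add: commutator_def word_simps)

text \<open>The Hall-Witt identity solved for one of its three terms. Since
  \<open>commutator G g a \<otimes> a\<close> is g a g^-1, that term is a product of conjugates of
  the other two, so it lies in every normal subgroup containing them.\<close>

lemma Hall_Witt:
  assumes "g \<in> carrier G" "a \<in> carrier G" "b \<in> carrier G"
  shows "commutator G (commutator G g a) b =
    (commutator G g a \<otimes> a) \<otimes>
      ((b \<otimes> commutator G (commutator G (inv b) (inv a)) g \<otimes> inv b)
        \<otimes> (g \<otimes> commutator G (commutator G (inv g) b) (inv a) \<otimes> inv g))
      \<otimes> inv (commutator G g a \<otimes> a)"
  using assms by (simp add: commutator_def word_simps)

end

text \<open>Degrees start at 1; degree 0 repeats the whole group, as in
  \<open>lower_central\<close>. The interface serves the lower central series, the additive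
  filtration of power series, and the stabilisers of such filtrations among automorphisms.\<close>

locale central_filtration = group G for G (structure) +
  fixes N :: "nat \<Rightarrow> 'a set"
  assumes N_0: "N 0 = carrier G"
    and N_1: "N (Suc 0) = carrier G"
    and N_subgroup: "subgroup (N k) G"
    and N_Suc: "N (Suc k) \<subseteq> N k"
    and N_commutator:
      "\<lbrakk>1 \<le> i; 1 \<le> j; x \<in> N i; y \<in> N j\<rbrakk> \<Longrightarrow> commutator G x y \<in> N (i + j)"
begin

lemma N_carrier: "x \<in> N k \<Longrightarrow> x \<in> carrier G"
  using N_subgroup subgroup.mem_carrier by fastforce

lemma N_one: "\<one> \<in> N k" and N_mult: "x \<in> N k \<Longrightarrow> y \<in> N k \<Longrightarrow> x \<otimes> y \<in> N k"
  and N_inv: "x \<in> N k \<Longrightarrow> inv x \<in> N k"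
  using N_subgroup[of k] by (auto simp: subgroup_def)

lemma N_antimono: "i \<le> j \<Longrightarrow> N j \<subseteq> N i"
  using N_Suc by (rule lift_Suc_antimono_le)

text \<open>Bracketing with an element of degree 1 raises the degree, so [g, x] lies in
  \<open>N k\<close>, and g x g^-1 = [g, x] x.\<close>

lemma N_conj: assumes "g \<in> carrier G" "x \<in> N k" shows "g \<otimes> x \<otimes> inv g \<in> N k"
proof (cases "k = 0")
  case True
  then show ?thesis using assms by (simp add: N_0)
next
  case False
  have "commutator G g x \<in> N k"
    using N_commutator[of 1 k g x] N_Suc[of k] assms False by (auto simp: N_1)
  moreover have "g \<otimes> x \<otimes> inv g = commutator G g x \<otimes> x"
    using assms N_carrier by (simp add: commutator_def word_simps)
  ultimately show ?thesis using assms N_mult by simp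
qed

lemma N_normal: "N k \<lhd> G"
  using N_conj N_subgroup normal_inv_iff by blast

lemma N_cong_mult:
  assumes "x \<otimes> inv y \<in> N k" "x \<in> carrier G" "y \<in> carrier G"
  shows "x \<in> N k \<longleftrightarrow> y \<in> N k"
proof
  assume "x \<in> N k"
  then have "inv (x \<otimes> inv y) \<otimes> x \<in> N k" using assms N_mult N_inv by blast
  then show "y \<in> N k" using assms by (simp add: word_simps)
next
  assume "y \<in> N k"
  then have "x \<otimes> inv y \<otimes> y \<in> N k" using assms N_mult by blast
  then show "x \<in> N k" using assms by (simp add: word_simps)
qed

end


section \<open>The lower central series is strongly central\<close>

lemma (in group) lower_central_Suc_Suc:
  "lower_central G (Suc (Suc k)) =
    generate G {commutator G g h |g h. g \<in> carrier G \<and> h \<in> lower_central G (Suc k)}"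
  unfolding lower_central.simps commutator_def by (rule arg_cong[where f = "generate G"]) blast

lemma (in group) lower_central_subgroup_Suc: "subgroup (lower_central G (Suc k)) G"
proof (induction k)
  case 0
  then show ?case by (simp add: subgroup_self)
next
  case (Suc k)
  then show ?case unfolding lower_central_Suc_Suc
    by (intro generate_is_subgroup) (auto dest: subgroup.mem_carrier)
qed

lemma (in group) lower_central_subgroup: "subgroup (lower_central G k) G"
  by (cases k) (use lower_central_subgroup_Suc subgroup_self in auto)

lemma (in group) commutator_lower_central:
  assumes "g \<in> carrier G" "h \<in> lower_central G (Suc k)"
  shows "commutator G g h \<in> lower_central G (Suc (Suc k))"
  unfolding lower_central_Suc_Suc using assms by (auto intro: generate.incl)

text \<open>The two claims support each other: normality of one term gives its inclusion of the
  next, and this inclusion together with g h g^-1 = [g, h] h gives normality of the next.\<close>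

lemma (in group) lower_central_normal_decreasing:
  "lower_central G (Suc k) \<lhd> G \<and> lower_central G (Suc (Suc k)) \<subseteq> lower_central G (Suc k)"
proof -
  have *: "lower_central G (Suc (Suc k)) \<subseteq> lower_central G (Suc k)"
    if n: "lower_central G (Suc k) \<lhd> G" for k
  proof -
    have "commutator G g h \<in> lower_central G (Suc k)"
      if "g \<in> carrier G" "h \<in> lower_central G (Suc k)" for g h
    proof -
      have "g \<otimes> h \<otimes> inv g \<in> lower_central G (Suc k)"
        using n that by (simp add: normal_inv_iff)
      then show ?thesis unfolding commutator_def
        using lower_central_subgroup that by (meson subgroup_def)
    qed
    then show ?thesis unfolding lower_central_Suc_Suc
      by (intro generate_subgroup_incl lower_central_subgroup) auto
  qed
  have "lower_central G (Suc k) \<lhd> G"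
  proof (induction k)
    case 0
    then show ?case by (simp add: normal_inv_iff subgroup_self)
  next
    case (Suc k)
    have "g \<otimes> h \<otimes> inv g \<in> lower_central G (Suc (Suc k))"
      if h: "h \<in> lower_central G (Suc (Suc k))" and g: "g \<in> carrier G" for g h
    proof -
      have "h \<in> lower_central G (Suc k)" using *[OF Suc] h by blast
      then have c: "commutator G g h \<in> lower_central G (Suc (Suc k))"
        using g by (intro commutator_lower_central) auto
      have "g \<otimes> h \<otimes> inv g = commutator G g h \<otimes> h"
        using g h lower_central_subgroup[THEN subgroup.mem_carrier]
        by (simp add: commutator_def word_simps del: lower_central.simps)
      then show ?thesis using c h lower_central_subgroup by (metis subgroup_def)
    qed
    then show ?case by (auto simp: normal_inv_iff lower_central_subgroup simp del: lower_central.simps)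
  qed
  then show ?thesis using * by blast
qed

text \<open>Three subgroups argument, by induction on the left degree. For a generator [g, a] of the
  left term, Hall-Witt trades [[g, a], y] for two commutators that the induction hypothesis for
  \<open>a\<close> controls. \<open>j\<close> varies because [g^-1, y] has one degree more than
  y.\<close>

lemma (in group) commutator_lower_central_add:
  assumes "x \<in> lower_central G (Suc i)" "y \<in> lower_central G (Suc j)"
  shows "commutator G x y \<in> lower_central G (Suc i + Suc j)"
  using assms
proof (induction i arbitrary: j x y)
  case 0
  then show ?case using commutator_lower_central[of x y j] by simp
next
  case (Suc i)
  let ?M = "lower_central G (Suc (Suc i) + Suc j)"
  have sM: "subgroup ?M G" by (rule lower_central_subgroup)
  have nM: "g \<otimes> z \<otimes> inv g \<in> ?M" if "z \<in> ?M" "g \<in> carrier G" for g z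
    using lower_central_normal_decreasing[of "Suc i + Suc j"] that by (auto simp: normal_inv_iff)
  note car = lower_central_subgroup[THEN subgroup.mem_carrier]
  have yc: "y \<in> carrier G" using car Suc.prems(2) by blast
  have gen: "commutator G (commutator G g a) y \<in> ?M"
    if g: "g \<in> carrier G" and a: "a \<in> lower_central G (Suc i)" for g a
  proof -
    have ac: "a \<in> carrier G" using car a by blast
    have inv_mem: "inv z \<in> lower_central G k" if "z \<in> lower_central G k" for z k
      using lower_central_subgroup that by (rule subgroup.m_inv_closed)
    have "commutator G (inv g) y \<in> lower_central G (Suc (Suc j))"
      using commutator_lower_central[of "inv g" y j] g Suc.prems(2) by simp
    then have "commutator G (inv a) (commutator G (inv g) y) \<in> ?M"
      using Suc.IH[of "inv a" _ "Suc j"] inv_mem[OF a] by (simp del: lower_central.simps)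
    then have 1: "commutator G (commutator G (inv g) y) (inv a) \<in> ?M"
      using inv_mem inv_commutator g ac yc by (metis commutator_closed inv_closed)
    have "commutator G (inv a) (inv y) \<in> lower_central G (Suc i + Suc j)"
      using Suc.IH inv_mem a Suc.prems(2) by blast
    then have "commutator G (inv y) (inv a) \<in> lower_central G (Suc i + Suc j)"
      using inv_mem inv_commutator ac yc by (metis inv_closed)
    then have "commutator G g (commutator G (inv y) (inv a)) \<in> ?M"
      using commutator_lower_central[of g _ "i + Suc j"] g by simp
    then have 2: "commutator G (commutator G (inv y) (inv a)) g \<in> ?M"
      using inv_mem inv_commutator g ac yc by (metis commutator_closed inv_closed)
    have "commutator G g a \<otimes> a \<in> carrier G" using g ac by simp
    then show ?thesis
      unfolding Hall_Witt[OF g ac yc]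
      by (intro nM subgroup.m_closed[OF sM] nM[OF 2 yc] nM[OF 1 g])
  qed
  have "x \<in> generate G {commutator G g h |g h. g \<in> carrier G \<and> h \<in> lower_central G (Suc i)}"
    using Suc.prems(1) unfolding lower_central_Suc_Suc .
  then have "x \<in> carrier G \<and> commutator G x y \<in> ?M"
  proof induction
    case one
    then show ?case using sM yc by (simp add: commutator_def subgroup.one_closed)
  next
    case (incl h)
    then show ?case using gen car by auto
  next
    case (inv h)
    then have h: "h \<in> carrier G" "commutator G h y \<in> ?M" using gen car by auto
    then have "inv (commutator G h y) \<in> ?M" using sM subgroup.m_inv_closed by metis
    from nM[OF this, of "inv h"] show ?case
      using h yc by (simp add: commutator_inv_left del: lower_central.simps)
  next
    case (eng h1 h2)
    then show ?case
      using nM sM yc by (simp add: commutator_mult_left subgroup.m_closed del: lower_central.simps)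
  qed
  then show ?case by simp
qed

lemma (in group) lower_central_filtration: "central_filtration G (lower_central G)"
proof (rule central_filtration.intro[OF is_group central_filtration_axioms.intro])
  show "lower_central G (Suc k) \<subseteq> lower_central G k" for k
    using lower_central_normal_decreasing by (cases k) auto
  show "commutator G x y \<in> lower_central G (i + j)"
    if "1 \<le> i" "1 \<le> j" "x \<in> lower_central G i" "y \<in> lower_central G j" for i j x y
    using commutator_lower_central_add[of x "i - 1" y "j - 1"] that by simp
qed (auto intro: lower_central_subgroup)

lemma group_hom_commutator:
  assumes "group_hom G H h" "x \<in> carrier G" "y \<in> carrier G"
  shows "h (commutator G x y) = commutator H (h x) (h y)"
proof -
  interpret group_hom G H h by fact
  show ?thesis using assms(2,3) by (simp add: commutator_def)
qed

text \<open>The lower central series descends fastest among strongly central filtrations. Inclusions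
  of groups, retractions of free groups and actions on power series all use this.\<close>

lemma hom_lower_central:
  assumes "group G" "central_filtration H N" "h \<in> hom G H" "x \<in> lower_central G k"
  shows "h x \<in> N k"
proof -
  interpret H: central_filtration H N by fact
  interpret G: group G by fact
  interpret hom: group_hom G H h by unfold_locales fact
  have *: "\<forall>x\<in>lower_central G (Suc k). h x \<in> N (Suc k)" for k
  proof (induction k)
    case 0
    then show ?case by (simp add: H.N_1)
  next
    case (Suc k)
    have c: "commutator G g a \<in> carrier G \<and> h (commutator G g a) \<in> N (Suc (Suc k))"
      if "g \<in> carrier G" "a \<in> lower_central G (Suc k)" for g a
    proof -
      have "a \<in> carrier G" using that G.lower_central_subgroup subgroup.mem_carrier by metis
      moreover have "commutator H (h g) (h a) \<in> N (1 + Suc k)"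
        using Suc that by (intro H.N_commutator) (auto simp: H.N_1)
      ultimately show ?thesis
        using that group_hom_commutator[OF hom.group_hom_axioms, of g a] by simp
    qed
    have "x \<in> carrier G \<and> h x \<in> N (Suc (Suc k))" if "x \<in> lower_central G (Suc (Suc k))" for x
      using that unfolding G.lower_central_Suc_Suc
    proof induction
      case (inv x)
      then show ?case using c H.N_inv by auto
    qed (use c in \<open>auto intro: H.N_one H.N_mult\<close>)
    then show ?case by blast
  qed
  show ?thesis
  proof (cases k)
    case 0
    then show ?thesis using assms(4) H.N_0 by simp
  qed (use * assms(4) in blast)
qed

subsection \<open>Automorphisms acting trivially on a filtration\<close>

lemma (in group) AutoGroup_mult:
  "\<sigma> \<in> auto G \<Longrightarrow> \<tau> \<in> auto G \<Longrightarrow> \<sigma> \<otimes>\<^bsub>AutoGroup G\<^esub> \<tau> = compose (carrier G) \<sigma> \<tau>"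
  by (simp add: AutoGroup_def BijGroup_def auto_def)

lemma (in group) AutoGroup_one: "\<one>\<^bsub>AutoGroup G\<^esub> = (\<lambda>x\<in>carrier G. x)"
  by (simp add: AutoGroup_def BijGroup_def)

lemma AutoGroup_carrier [simp]: "carrier (AutoGroup G) = auto G"
  by (simp add: AutoGroup_def)

lemma autoD:
  assumes "\<sigma> \<in> auto G"
  shows auto_hom: "\<sigma> \<in> hom G G" and auto_closed: "x \<in> carrier G \<Longrightarrow> \<sigma> x \<in> carrier G"
    and auto_mult: "\<lbrakk>x \<in> carrier G; y \<in> carrier G\<rbrakk> \<Longrightarrow> \<sigma> (x \<otimes>\<^bsub>G\<^esub> y) = \<sigma> x \<otimes>\<^bsub>G\<^esub> \<sigma> y"
  using assms by (auto simp: auto_def hom_def)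

lemma (in group) auto_inv:
  assumes "\<sigma> \<in> auto G" "x \<in> carrier G" shows "\<sigma> (inv x) = inv (\<sigma> x)"
proof -
  interpret group_hom G G \<sigma> by unfold_locales (rule auto_hom[OF assms(1)])
  show ?thesis using assms by simp
qed

lemma (in group) auto_inverse_apply:
  assumes "\<sigma> \<in> auto G" "x \<in> carrier G"
  shows "\<sigma> ((inv\<^bsub>AutoGroup G\<^esub> \<sigma>) x) = x" "(inv\<^bsub>AutoGroup G\<^esub> \<sigma>) (\<sigma> x) = x"
proof -
  interpret A: group "AutoGroup G" by (rule AutoGroup)
  have i: "inv\<^bsub>AutoGroup G\<^esub> \<sigma> \<in> auto G" using A.inv_closed assms by simp
  have "(\<sigma> \<otimes>\<^bsub>AutoGroup G\<^esub> inv\<^bsub>AutoGroup G\<^esub> \<sigma>) x = x"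
    "(inv\<^bsub>AutoGroup G\<^esub> \<sigma> \<otimes>\<^bsub>AutoGroup G\<^esub> \<sigma>) x = x"
    using A.r_inv[of \<sigma>] A.l_inv[of \<sigma>] assms by (simp_all add: AutoGroup_one)
  then show "\<sigma> ((inv\<^bsub>AutoGroup G\<^esub> \<sigma>) x) = x" "(inv\<^bsub>AutoGroup G\<^esub> \<sigma>) (\<sigma> x) = x"
    using assms i by (simp_all add: AutoGroup_mult compose_def)
qed

text \<open>The \<open>max\<close> makes indices 0 and 1 agree, as \<open>central_filtration\<close>
  requires. Index 1 already means trivial action on all quotients of consecutive terms.\<close>

definition stabiliser :: "('a, 'b) monoid_scheme \<Rightarrow> (nat \<Rightarrow> 'a set) \<Rightarrow> nat \<Rightarrow> ('a \<Rightarrow> 'a) set" where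
  "stabiliser G H k = {\<sigma> \<in> auto G. \<forall>l. \<forall>h\<in>H l. \<sigma> h \<otimes>\<^bsub>G\<^esub> inv\<^bsub>G\<^esub> h \<in> H (l + max 1 k)}"

abbreviation stabiliser_group where
  "stabiliser_group G H \<equiv> (AutoGroup G)\<lparr>carrier := stabiliser G H (Suc 0)\<rparr>"

context central_filtration
begin

lemma stabiliser_auto: "\<sigma> \<in> stabiliser G N k \<Longrightarrow> \<sigma> \<in> auto G"
  by (simp add: stabiliser_def)

lemma stabiliser_step:
  "\<sigma> \<in> stabiliser G N k \<Longrightarrow> h \<in> N l \<Longrightarrow> \<sigma> h \<otimes> inv h \<in> N (l + max 1 k)"
  by (simp add: stabiliser_def)

lemma stabiliser_preserves:
  assumes "\<sigma> \<in> stabiliser G N k" "h \<in> N l" shows "\<sigma> h \<in> N l"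
proof -
  have "\<sigma> h \<otimes> inv h \<in> N l" using stabiliser_step[OF assms] N_antimono by (meson le_add1 subsetD)
  then show ?thesis
    using N_cong_mult assms N_carrier auto_closed stabiliser_auto by metis
qed

text \<open>Climbs one degree at a time: if h has degree m, then h and \<sigma> h agree modulo
  degree m + 1, so h inherits that degree from \<sigma> h. This is what controls inverses.\<close>

lemma stabiliser_reflects:
  assumes s: "\<sigma> \<in> stabiliser G N k" and h: "h \<in> carrier G" "\<sigma> h \<in> N l" shows "h \<in> N l"
proof -
  have "h \<in> N m" if "m \<le> l" for m using that
  proof (induction m)
    case 0
    then show ?case using h by (simp add: N_0)
  next
    case (Suc m)
    then have "\<sigma> h \<otimes> inv h \<in> N (m + max 1 k)" using stabiliser_step[OF s] by simp
    then have "\<sigma> h \<otimes> inv h \<in> N (Suc m)"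
      using N_antimono[of "Suc m" "m + max 1 k"] by auto
    moreover have "\<sigma> h \<in> N (Suc m)" using h N_antimono Suc.prems by blast
    ultimately show ?case
      using N_cong_mult h N_carrier by metis
  qed
  then show ?thesis by simp
qed

lemma subgroup_stabiliser: "subgroup (stabiliser G N k) (AutoGroup G)"
proof
  interpret A: group "AutoGroup G" by (rule AutoGroup)
  show "stabiliser G N k \<subseteq> carrier (AutoGroup G)" using stabiliser_auto by auto
  show "\<one>\<^bsub>AutoGroup G\<^esub> \<in> stabiliser G N k"
    using id_in_auto N_carrier N_one by (auto simp: stabiliser_def AutoGroup_one)
  show "\<sigma> \<otimes>\<^bsub>AutoGroup G\<^esub> \<tau> \<in> stabiliser G N k"
    if s: "\<sigma> \<in> stabiliser G N k" and t: "\<tau> \<in> stabiliser G N k" for \<sigma> \<tau>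
  proof -
    have a: "\<sigma> \<in> auto G" "\<tau> \<in> auto G" using s t stabiliser_auto by auto
    have "compose (carrier G) \<sigma> \<tau> h \<otimes> inv h \<in> N (l + max 1 k)" if h: "h \<in> N l" for h l
    proof -
      have hc: "h \<in> carrier G" using h N_carrier by blast
      have "\<sigma> (\<tau> h) \<otimes> inv (\<tau> h) \<otimes> (\<tau> h \<otimes> inv h) \<in> N (l + max 1 k)"
        using h s t stabiliser_step stabiliser_preserves N_mult by metis
      then show ?thesis using hc a auto_closed[OF a(1)] auto_closed[OF a(2)]
        by (simp add: compose_def word_simps)
    qed
    moreover have "compose (carrier G) \<sigma> \<tau> \<in> auto G"
      using A.m_closed[of \<sigma> \<tau>] a by (simp add: AutoGroup_mult)
    ultimately show ?thesis using a by (simp add: AutoGroup_mult stabiliser_def)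
  qed
  show "inv\<^bsub>AutoGroup G\<^esub> \<sigma> \<in> stabiliser G N k" if s: "\<sigma> \<in> stabiliser G N k" for \<sigma>
  proof -
    let ?i = "inv\<^bsub>AutoGroup G\<^esub> \<sigma>"
    have a: "\<sigma> \<in> auto G" using s stabiliser_auto by auto
    then have i: "?i \<in> auto G" using A.inv_closed by simp
    have "?i h \<otimes> inv h \<in> N (l + max 1 k)" if h: "h \<in> N l" for h l
    proof -
      have hc: "h \<in> carrier G" "?i h \<in> carrier G" using h N_carrier i auto_closed by metis+
      have "?i h \<in> N l" using stabiliser_reflects[OF s hc(2)] auto_inverse_apply[OF a] hc h by simp
      then have "\<sigma> (?i h) \<otimes> inv (?i h) \<in> N (l + max 1 k)" using s stabiliser_step by blast
      then have "inv (h \<otimes> inv (?i h)) \<in> N (l + max 1 k)"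
        using N_inv auto_inverse_apply[OF a] hc by simp
      then show ?thesis using hc by (simp add: word_simps)
    qed
    then show ?thesis using i by (simp add: stabiliser_def)
  qed
qed

lemma stabiliser_commutator:
  assumes s: "\<sigma> \<in> stabiliser G N i" and t: "\<tau> \<in> stabiliser G N j" and ij: "1 \<le> i" "1 \<le> j"
  shows "commutator (AutoGroup G) \<sigma> \<tau> \<in> stabiliser G N (i + j)"
proof -
  interpret A: group "AutoGroup G" by (rule AutoGroup)
  have a: "\<sigma> \<in> auto G" "\<tau> \<in> auto G" using s t stabiliser_auto by auto
  define \<rho> where "\<rho> = commutator (AutoGroup G) \<sigma> \<tau>"
  have r: "\<rho> \<in> auto G" using A.commutator_closed a unfolding \<rho>_def by simp
  note closed = auto_closed[OF a(1)] auto_closed[OF a(2)] auto_closed[OF r]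
  have "\<rho> \<otimes>\<^bsub>AutoGroup G\<^esub> (\<tau> \<otimes>\<^bsub>AutoGroup G\<^esub> \<sigma>) = \<sigma> \<otimes>\<^bsub>AutoGroup G\<^esub> \<tau>"
    using a[folded AutoGroup_carrier] unfolding \<rho>_def
    by (simp add: commutator_def A.word_simps del: AutoGroup_carrier)
  then have eq: "\<rho> (\<tau> (\<sigma> x)) = \<sigma> (\<tau> x)" if "x \<in> carrier G" for x
    using that a r A.m_closed[of \<tau> \<sigma>] by (auto simp: AutoGroup_mult compose_def dest: fun_cong[where x = x])
  have "\<rho> h \<otimes> inv h \<in> N (l + max 1 (i + j))" if h: "h \<in> N l" for h l
  proof -
    have hc: "h \<in> carrier G" using h N_carrier by blast
    \<comment> \<open>With h = \<tau> (\<sigma> x), the value \<rho> h = \<sigma> (\<tau> x)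
      involves no inverse automorphism.\<close>
    define x where "x = (inv\<^bsub>AutoGroup G\<^esub> \<sigma>) ((inv\<^bsub>AutoGroup G\<^esub> \<tau>) h)"
    have ic: "(inv\<^bsub>AutoGroup G\<^esub> \<tau>) h \<in> carrier G" "x \<in> carrier G"
      unfolding x_def using hc A.inv_closed a auto_closed by (metis AutoGroup_carrier)+
    have hx: "\<tau> (\<sigma> x) = h" unfolding x_def using auto_inverse_apply(1)[OF a(1)] auto_inverse_apply(1)[OF a(2)] hc ic by simp
    have xl: "x \<in> N l" using stabiliser_reflects[OF s ic(2)] stabiliser_reflects[OF t, of "\<sigma> x"] hx h closed ic by simp
    define p q where "p = \<sigma> x \<otimes> inv x" and "q = \<tau> x \<otimes> inv x"
    have p: "p \<in> N (l + i)" and q: "q \<in> N (l + j)"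
      using stabiliser_step[OF s xl] stabiliser_step[OF t xl] ij unfolding p_def q_def by simp_all
    have c: "p \<in> carrier G" "q \<in> carrier G" using p q N_carrier by auto
    have "\<sigma> q \<otimes> inv q \<in> N (l + j + i)" using stabiliser_step[OF s q] ij by simp
    then have 1: "\<sigma> q \<otimes> inv q \<in> N (l + (i + j))" by (simp add: ac_simps)
    have "commutator G q p \<in> N ((l + j) + (l + i))" using N_commutator p q ij by simp
    then have 2: "commutator G q p \<in> N (l + (i + j))"
      using N_antimono[of "l + (i + j)" "(l + j) + (l + i)"] by auto
    have "\<tau> p \<otimes> inv p \<in> N (l + i + j)" using stabiliser_step[OF t p] ij by simp
    then have 3: "inv (\<tau> p \<otimes> inv p) \<in> N (l + (i + j))" using N_inv by (simp add: ac_simps)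
    have "\<sigma> x = p \<otimes> x" "\<tau> x = q \<otimes> x" using ic closed by (simp_all add: p_def q_def word_simps)
    then have e: "\<rho> h = \<sigma> q \<otimes> (p \<otimes> x)" "h = \<tau> p \<otimes> (q \<otimes> x)"
      using eq[OF ic(2)] hx c ic auto_mult[OF a(1)] auto_mult[OF a(2)] by metis+
    \<comment> \<open>From \<rho> h = \<sigma> q p x and h = \<tau> p q x the factor x cancels;
      inserting q^-1 q and p^-1 p leaves three factors of degree at least l + i + j.\<close>
    have "\<rho> h \<otimes> inv h = \<sigma> q \<otimes> inv q \<otimes> commutator G q p \<otimes> inv (\<tau> p \<otimes> inv p)"
      unfolding e(1) by (subst e(2)) (use c closed ic in \<open>simp add: commutator_def word_simps\<close>)
    then show ?thesis using 1 2 3 N_mult ij by (simp add: max_def)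
  qed
  then show ?thesis using r by (simp add: stabiliser_def \<rho>_def)
qed

text \<open>Applied twice: to the lower central series of F_n, where it makes the Andreadakis
  filtration strongly central, and to power series, where it gives groups of unipotent
  operators.\<close>

lemma stabiliser_filtration: "central_filtration (stabiliser_group G N) (stabiliser G N)"
proof -
  interpret A: group "AutoGroup G" by (rule AutoGroup)
  let ?S = "stabiliser_group G N"
  have sub: "subgroup (stabiliser G N (Suc 0)) (AutoGroup G)" by (rule subgroup_stabiliser)
  have anti: "stabiliser G N (Suc k) \<subseteq> stabiliser G N k" for k
    using N_antimono[of "l + max 1 k" "l + max 1 (Suc k)" for l]
    unfolding stabiliser_def by fastforce
  have le: "stabiliser G N k \<subseteq> stabiliser G N (Suc 0)" for k
  proof (induction k)
    case 0
    then show ?case by (simp add: stabiliser_def)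
  next
    case (Suc k)
    then show ?case using anti[of k] by simp
  qed
  show ?thesis
  proof (rule central_filtration.intro[OF A.subgroup_imp_group[OF sub] central_filtration_axioms.intro])
    show "stabiliser G N 0 = carrier ?S" by (simp add: stabiliser_def)
    show "subgroup (stabiliser G N k) ?S" for k
      using A.subgroup_incl subgroup_stabiliser le by blast
    show "commutator ?S x y \<in> stabiliser G N (i + j)"
      if "1 \<le> i" "1 \<le> j" "x \<in> stabiliser G N i" "y \<in> stabiliser G N j" for i j x y
    proof -
      have "x \<in> stabiliser G N (Suc 0)" "y \<in> stabiliser G N (Suc 0)" using that le by auto
      then have "commutator ?S x y = commutator (AutoGroup G) x y"
        using A.m_inv_consistent[OF sub] by (simp add: commutator_def)
      then show ?thesis using stabiliser_commutator that by simp
    qed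
  qed (use anti in auto)
qed

end


section \<open>Words and free groups\<close>

fun word_eval :: "('a, 'b) monoid_scheme \<Rightarrow> (nat \<Rightarrow> 'a) \<Rightarrow> letter list \<Rightarrow> 'a" where
  "word_eval G f [] = \<one>\<^bsub>G\<^esub>"
| "word_eval G f (a # w) =
     (if snd a then f (fst a) else inv\<^bsub>G\<^esub> f (fst a)) \<otimes>\<^bsub>G\<^esub> word_eval G f w"

definition inverse_word :: "letter list \<Rightarrow> letter list" where
  "inverse_word w = rev (map (\<lambda>a. (fst a, \<not> snd a)) w)"

lemma inverse_word_Nil [simp]: "inverse_word [] = []"
  and inverse_word_Cons [simp]: "inverse_word (a # w) = inverse_word w @ [(fst a, \<not> snd a)]"
  by (simp_all add: inverse_word_def)

lemma letters_inverse_word [simp]: "fst ` set (inverse_word w) = fst ` set w"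
  by (induction w) auto

context group
begin

lemma word_eval_closed [simp]: "range f \<subseteq> carrier G \<Longrightarrow> word_eval G f w \<in> carrier G"
  by (induction w) auto

lemma word_eval_append:
  "range f \<subseteq> carrier G \<Longrightarrow> word_eval G f (u @ v) = word_eval G f u \<otimes> word_eval G f v"
proof (induction u)
  case (Cons a u)
  have "f (fst a) \<in> carrier G" using Cons.prems by auto
  then show ?case using Cons by (simp add: m_assoc)
qed simp

lemma word_eval_inverse_word:
  "range f \<subseteq> carrier G \<Longrightarrow> word_eval G f (inverse_word w) = inv (word_eval G f w)"
proof (induction w)
  case (Cons a u)
  have "f (fst a) \<in> carrier G" using Cons.prems by auto
  then show ?case using Cons by (simp add: word_eval_append inv_mult_group)
qed simp

lemma word_eval_subgroup:
  assumes "subgroup H G" "\<And>a. a \<in> set w \<Longrightarrow> f (fst a) \<in> H"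
  shows "word_eval G f w \<in> H"
  using assms(2)
  by (induction w) (auto intro: subgroup.m_closed[OF assms(1)] subgroup.m_inv_closed[OF assms(1)]
      subgroup.one_closed[OF assms(1)])

end

lemma word_eval_cong:
  "(\<And>a. a \<in> set w \<Longrightarrow> f (fst a) = g (fst a)) \<Longrightarrow> word_eval G f w = word_eval G g w"
  by (induction w) auto

lemma hom_word_eval:
  assumes "group_hom G H h" "range f \<subseteq> carrier G"
  shows "h (word_eval G f w) = word_eval H (\<lambda>s. h (f s)) w"
proof -
  interpret group_hom G H h by fact
  show ?thesis
  proof (induction w)
    case (Cons a w)
    have "f (fst a) \<in> carrier G" using assms by auto
    then show ?case using Cons assms by simp
  qed simp
qed

section \<open>Free reduction and the free group\<close>

lemma reduced_tl: "reduced (a # w) \<Longrightarrow> reduced w"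
  by (cases w) auto

lemma reduced_cancel_cons: "reduced w \<Longrightarrow> reduced (cancel_cons a w)"
  by (cases w) (auto dest: reduced_tl)

lemma cancel_cons_reduced: "reduced (a # w) \<Longrightarrow> cancel_cons a w = a # w"
  by (cases w) auto

text \<open>Van der Waerden's argument: letters act on reduced words by \<open>cancel_cons\<close>,
  inverse letters by inverse permutations. Hence a word and its reduction act alike
  (\<open>foldr_reduce\<close>), which yields associativity.\<close>

lemma cancel_cons_inverse:
  assumes "inverse_letters a b" "reduced w"
  shows "cancel_cons a (cancel_cons b w) = w"
proof (cases w)
  case (Cons c u)
  have "a = c" if "inverse_letters b c"
    using that assms(1) by (auto simp: inverse_letters_def prod_eq_iff)
  then show ?thesis
    using assms Cons cancel_cons_reduced[of c u] by auto
qed (use assms in auto)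

lemma reduced_foldr: "reduced v \<Longrightarrow> reduced (foldr cancel_cons u v)"
  by (induction u) (auto intro: reduced_cancel_cons)

lemma foldr_cancel_cons:
  assumes "reduced v"
  shows "foldr cancel_cons (cancel_cons a u) v = cancel_cons a (foldr cancel_cons u v)"
  using assms by (cases u) (auto simp: cancel_cons_inverse reduced_foldr)

lemma foldr_reduce: "reduced v \<Longrightarrow> foldr cancel_cons (reduce u) v = foldr cancel_cons u v"
  unfolding reduce_def by (induction u) (auto simp: foldr_cancel_cons)

lemma reduce_append: "reduce (u @ v) = foldr cancel_cons u (reduce v)"
  by (simp add: reduce_def)

lemma reduced_reduce: "reduced (reduce w)"
  by (simp add: reduce_def reduced_foldr)

lemma reduce_reduced: "reduced w \<Longrightarrow> reduce w = w"
  unfolding reduce_def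
proof (induction w)
  case (Cons a w)
  then show ?case using reduced_tl[of a w] by (simp add: cancel_cons_reduced)
qed simp

lemma set_reduce: "set (reduce w) \<subseteq> set w"
proof -
  have "set (cancel_cons a u) \<subseteq> insert a (set u)" for a u by (cases u) auto
  then show ?thesis unfolding reduce_def by (induction w) fastforce+
qed

lemma foldr_inverse_word:
  "reduced v \<Longrightarrow> foldr cancel_cons (inverse_word w) (foldr cancel_cons w v) = v"
proof (induction w)
  case (Cons a w)
  then show ?case
    by (simp add: cancel_cons_inverse inverse_letters_def reduced_foldr)
qed simp

lemma free_group_simps [simp]:
  "carrier (free_group n) = {w. reduced w \<and> (\<forall>a\<in>set w. fst a < n)}"
  "u \<otimes>\<^bsub>free_group n\<^esub> v = reduce (u @ v)" "\<one>\<^bsub>free_group n\<^esub> = []"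
  by (simp_all add: free_group_def)

lemma group_free_group: "group (free_group n)"
proof (rule groupI)
  fix u v w
  assume "u \<in> carrier (free_group n)" "v \<in> carrier (free_group n)" "w \<in> carrier (free_group n)"
  then show "u \<otimes>\<^bsub>free_group n\<^esub> v \<otimes>\<^bsub>free_group n\<^esub> w = u \<otimes>\<^bsub>free_group n\<^esub> (v \<otimes>\<^bsub>free_group n\<^esub> w)"
    using foldr_reduce[of w "u @ v"] reduce_append[of "reduce (u @ v)" w]
      reduce_append[of u "reduce (v @ w)"] reduce_append[of v w]
    by (simp add: reduce_reduced reduced_reduce reduced_foldr)
next
  fix w
  assume w: "w \<in> carrier (free_group n)"
  have "fst ` set (reduce (inverse_word w)) \<subseteq> fst ` set w"
    using set_reduce[of "inverse_word w"] letters_inverse_word by blast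
  then have "reduce (inverse_word w) \<in> carrier (free_group n)"
    using w reduced_reduce by fastforce
  moreover have "reduce (inverse_word w) \<otimes>\<^bsub>free_group n\<^esub> w = \<one>\<^bsub>free_group n\<^esub>"
    using foldr_inverse_word[of "[]" w] w by (simp add: reduce_append foldr_reduce reduced_reduce) (simp add: reduce_def)
  ultimately show "\<exists>y\<in>carrier (free_group n). y \<otimes>\<^bsub>free_group n\<^esub> w = \<one>\<^bsub>free_group n\<^esub>" by blast
qed (use set_reduce reduced_reduce in \<open>fastforce simp: reduce_reduced\<close>)+

interpretation F: group "free_group n" for n
  by (rule group_free_group)

lemma (in group) word_eval_reduce:
  assumes "range f \<subseteq> carrier G"
  shows "word_eval G f (reduce w) = word_eval G f w"
proof -
  have "word_eval G f (cancel_cons a u) = word_eval G f (a # u)" for a u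
  proof (cases u)
    case (Cons b v)
    have "f s \<in> carrier G" for s using assms by auto
    then show ?thesis using Cons assms
      by (auto simp: inverse_letters_def inv_mult_cancel)
  qed simp
  then show ?thesis unfolding reduce_def by (induction w) auto
qed

lemma (in group) word_eval_hom:
  "range f \<subseteq> carrier G \<Longrightarrow> word_eval G f \<in> hom (free_group n) G"
  by (auto simp: hom_def word_eval_reduce word_eval_append)

text \<open>Generators of index at least \<open>n\<close> are sent to the identity, to have total assignments.\<close>

definition fgen :: "nat \<Rightarrow> nat \<Rightarrow> letter list" where
  "fgen n s = (if s < n then gen s else [])"

lemma gen_closed: "i < n \<Longrightarrow> gen i \<in> carrier (free_group n)"
  by (simp add: gen_def)

lemma range_fgen: "k \<le> n \<Longrightarrow> range (fgen k) \<subseteq> carrier (free_group n)"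
  by (auto simp: fgen_def gen_def)

lemma inv_gen: "i < n \<Longrightarrow> inv\<^bsub>free_group n\<^esub> gen i = [(i, False)]"
  by (intro F.inv_equality) (auto simp: gen_def reduce_def inverse_letters_def)

text \<open>Lets questions about elements of F_n be settled by evaluating words: a reduced word is
  its own value at the generators.\<close>

lemma word_eval_fgen:
  assumes "w \<in> carrier (free_group n)" shows "word_eval (free_group n) (fgen n) w = w"
proof -
  have "word_eval (free_group n) (fgen n) w = reduce w" if "\<forall>a\<in>set w. fst a < n" for w
    using that
  proof (induction w)
    case (Cons a w)
    have "(if snd a then fgen n (fst a) else inv\<^bsub>free_group n\<^esub> fgen n (fst a)) = [a]"
      using Cons.prems inv_gen by (cases a) (auto simp: fgen_def gen_def)
    moreover have "reduce ([a] @ reduce w) = reduce ([a] @ w)"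
      unfolding reduce_append[of "[a]"] by (simp add: reduce_reduced reduced_reduce)
    ultimately show ?case using Cons by simp
  qed (simp add: reduce_def)
  then show ?thesis using assms by (simp add: reduce_reduced)
qed

lemma free_group_hom_eq:
  assumes "group H" "h \<in> hom (free_group n) H" "w \<in> carrier (free_group n)"
  shows "h w = word_eval H (\<lambda>s. h (fgen n s)) w"
proof -
  interpret H: group H by fact
  have "group_hom (free_group n) H h" using assms(2) by unfold_locales
  then show ?thesis using hom_word_eval[of "free_group n" H h "fgen n" w] word_eval_fgen assms(3) range_fgen
    by simp
qed

lemma free_group_hom_eqI:
  assumes "group H" "h \<in> hom (free_group n) H" "h' \<in> hom (free_group n) H"
    and "\<And>i. i < n \<Longrightarrow> h (gen i) = h' (gen i)" "w \<in> carrier (free_group n)"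
  shows "h w = h' w"
  unfolding free_group_hom_eq[OF assms(1,2,5)] free_group_hom_eq[OF assms(1,3,5)]
  by (rule word_eval_cong) (use assms(4,5) in \<open>auto simp: fgen_def\<close>)

section \<open>Free groups on initial segments of the basis\<close>

lemma free_group_mono: "k \<le> n \<Longrightarrow> carrier (free_group k) \<subseteq> carrier (free_group n)"
  by auto

lemma subgroup_free_group: "k \<le> n \<Longrightarrow> subgroup (carrier (free_group k)) (free_group n)"
proof (rule F.subgroupI)
  fix w assume k: "k \<le> n" and w: "w \<in> carrier (free_group k)"
  have "inv\<^bsub>free_group n\<^esub> w = inv\<^bsub>free_group k\<^esub> w"
    using F.l_inv[OF w] F.inv_closed[OF w] w k free_group_mono[OF k]
    by (intro F.inv_equality) auto
  then show "inv\<^bsub>free_group n\<^esub> w \<in> carrier (free_group k)" using F.inv_closed[OF w] by simp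
next
  show "u \<otimes>\<^bsub>free_group n\<^esub> v \<in> carrier (free_group k)"
    if "u \<in> carrier (free_group k)" "v \<in> carrier (free_group k)" for u v
    using that F.m_closed[of u k v] by simp
qed (auto intro: exI[of _ "[]"])

text \<open>Elements are reduced words in named letters, so the subgroup generated by the first k
  letters is literally the carrier of a smaller free group, not just isomorphic to it.\<close>

lemma initial_subgroup_eq:
  assumes "k \<le> n" shows "initial_subgroup n k = carrier (free_group k)"
proof
  show "initial_subgroup n k \<subseteq> carrier (free_group k)"
    unfolding initial_subgroup_def using assms gen_closed
    by (intro F.generate_subgroup_incl subgroup_free_group) blast+
  have "gen ` {i. i < k} \<subseteq> carrier (free_group n)" using assms gen_closed by force
  from F.generate_is_subgroup[OF this] have "w \<in> initial_subgroup n k"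
    if "w \<in> carrier (free_group k)" for w
  proof -
    have "word_eval (free_group n) (fgen n) w \<in> initial_subgroup n k"
      unfolding initial_subgroup_def
      using \<open>subgroup (generate (free_group n) (gen ` {i. i < k})) (free_group n)\<close>
      by (rule F.word_eval_subgroup) (use that assms in \<open>auto simp: fgen_def intro!: generate.incl\<close>)
    then show ?thesis using word_eval_fgen that free_group_mono[OF assms] by (metis subsetD)
  qed
  then show "carrier (free_group k) \<subseteq> initial_subgroup n k" by blast
qed

lemma free_group_restrict: "(free_group n)\<lparr>carrier := carrier (free_group k)\<rparr> = free_group k"
  by (simp add: free_group_def)

lemma inv_free_group_mono:
  "k \<le> n \<Longrightarrow> w \<in> carrier (free_group k) \<Longrightarrow> inv\<^bsub>free_group n\<^esub> w = inv\<^bsub>free_group k\<^esub> w"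
  using F.m_inv_consistent[OF subgroup_free_group, of k n w] by (simp only: free_group_restrict)

declare free_group_simps [simp del]

section \<open>Elimination of a generator\<close>

text \<open>The letter \<open>prod_encode (x, m)\<close> stands for the iterated commutator
  \<open>[t, [t, \<dots>, [t, x]]]\<close> with \<open>m\<close> occurrences of the eliminated letter \<open>t\<close>.\<close>

definition letter_base :: "nat \<Rightarrow> nat" where "letter_base p = fst (prod_decode p)"
definition letter_depth :: "nat \<Rightarrow> nat" where "letter_depth p = snd (prod_decode p)"
definition letter_Suc :: "nat \<Rightarrow> nat" where
  "letter_Suc p = prod_encode (letter_base p, Suc (letter_depth p))"

lemma letter_simps [simp]:
  "letter_base (prod_encode (x, m)) = x" "letter_depth (prod_encode (x, m)) = m"
  "letter_base (letter_Suc p) = letter_base p" "letter_depth (letter_Suc p) = Suc (letter_depth p)"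
  by (simp_all add: letter_base_def letter_depth_def letter_Suc_def)

text \<open>The word for t w t^-1, where t p t^-1 = [t, p] p; an inverse letter gives p^-1
  [t, p]^-1.\<close>

fun conj_up :: "letter list \<Rightarrow> letter list" where
  "conj_up [] = []"
| "conj_up (a # w) = (if snd a then [(letter_Suc (fst a), True), a]
     else [a, (letter_Suc (fst a), False)]) @ conj_up w"

text \<open>Since \<open>t p t\<inverse> = letter_Suc p \<cdot> p\<close>, the conjugate \<open>t\<inverse> p t\<close> equals
  \<open>(t\<inverse> (letter_Suc p) t)\<inverse> p\<close>; the recursion stops where the letters have become trivial.\<close>

fun conj_down_letter :: "nat \<Rightarrow> nat \<Rightarrow> letter list" where
  "conj_down_letter 0 p = []"
| "conj_down_letter (Suc r) p = inverse_word (conj_down_letter r (letter_Suc p)) @ [(p, True)]"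

fun conj_down :: "nat \<Rightarrow> letter list \<Rightarrow> letter list" where
  "conj_down k [] = []"
| "conj_down k (a # w) = (if snd a then conj_down_letter k (fst a)
     else inverse_word (conj_down_letter k (fst a))) @ conj_down k w"

text \<open>Collects all occurrences of t at the right end. If the tail is u t^a, a further t in
  front gives (t u t^-1) t^(a+1). Only u is returned; the power of t is recovered by a
  \<open>filter\<close>.\<close>

fun elim_letter :: "nat \<Rightarrow> nat \<Rightarrow> letter list \<Rightarrow> letter list" where
  "elim_letter k t [] = []"
| "elim_letter k t (a # w) =
    (if fst a = t then (if snd a then conj_up else conj_down k) (elim_letter k t w)
     else (prod_encode (fst a, 0), snd a) # elim_letter k t w)"

abbreviation avoids :: "nat \<Rightarrow> letter list \<Rightarrow> bool" where
  "avoids t w \<equiv> list_all (\<lambda>a. letter_base (fst a) \<noteq> t) w"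

lemma avoids_inverse_word: "avoids t (inverse_word w) = avoids t w"
  by (induction w) auto

lemma avoids_conj_up: "avoids t w \<Longrightarrow> avoids t (conj_up w)"
  by (induction w) auto

lemma avoids_conj_down_letter: "letter_base p \<noteq> t \<Longrightarrow> avoids t (conj_down_letter r p)"
  by (induction r arbitrary: p) (auto simp: avoids_inverse_word)

lemma avoids_conj_down: "avoids t w \<Longrightarrow> avoids t (conj_down k w)"
  by (induction w) (auto simp: avoids_inverse_word avoids_conj_down_letter)

lemma avoids_elim_letter: "avoids t (elim_letter k t w)"
  by (induction w) (auto simp: avoids_conj_up avoids_conj_down)

lemma (in group) word_eval_elim_letter:
  assumes f: "range f \<subseteq> carrier G" and g: "range g \<subseteq> carrier G"
    and base: "\<And>x. x \<noteq> t \<Longrightarrow> g (prod_encode (x, 0)) = f x"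
    and step: "\<And>p. letter_base p \<noteq> t \<Longrightarrow> g (letter_Suc p) = commutator G (f t) (g p)"
    and stop: "\<And>p. letter_base p \<noteq> t \<Longrightarrow> k \<le> letter_depth p \<Longrightarrow> g p = \<one>"
  shows "word_eval G f w =
    word_eval G g (elim_letter k t w) \<otimes> word_eval G f (filter (\<lambda>a. fst a = t) w)"
proof -
  have [simp]: "f s \<in> carrier G" "g s \<in> carrier G" for s using f g by auto
  have up: "word_eval G g (conj_up u) = f t \<otimes> word_eval G g u \<otimes> inv f t" if "avoids t u" for u
    using that
  proof (induction u)
    case (Cons a u)
    then have "g (letter_Suc (fst a)) = commutator G (f t) (g (fst a))" using step by simp
    then show ?case using Cons g by (simp add: commutator_def word_simps)
  qed simp
  \<comment> \<open>The second hypothesis says that \<open>r\<close> steps suffice to reach depth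
    \<open>k\<close>, where letters are trivial and the empty word is correct.\<close>
  have down_letter: "word_eval G g (conj_down_letter r p) = inv f t \<otimes> g p \<otimes> f t"
    if "letter_base p \<noteq> t" "k \<le> letter_depth p + r" for r p
    using that
  proof (induction r arbitrary: p)
    case 0
    then show ?case using stop by simp
  next
    case (Suc r)
    then show ?case
      using g by (simp add: word_eval_append word_eval_inverse_word step commutator_def word_simps)
  qed
  have down: "word_eval G g (conj_down k u) = inv f t \<otimes> word_eval G g u \<otimes> f t" if "avoids t u" for u
    using that
  proof (induction u)
    case (Cons a u)
    then have "word_eval G g (conj_down_letter k (fst a)) = inv f t \<otimes> g (fst a) \<otimes> f t"
      by (intro down_letter) auto
    then show ?case using Cons g
      by (simp add: word_eval_append word_eval_inverse_word word_simps)
  qed simp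
  show ?thesis
  proof (induction w)
    case (Cons a w)
    then show ?case using f g up down avoids_elim_letter[of t k w] base
      by (auto simp: word_simps)
  qed simp
qed

text \<open>Letters of depth at least \<open>k\<close> are trivial only modulo \<open>N k\<close>,
  so the exact identity is applied in the quotient group and lifted.\<close>

lemma (in central_filtration) word_eval_elim_letter_mod:
  assumes f: "range f \<subseteq> carrier G" and g: "range g \<subseteq> carrier G"
    and base: "\<And>x. x \<noteq> t \<Longrightarrow> g (prod_encode (x, 0)) = f x"
    and step: "\<And>p. letter_base p \<noteq> t \<Longrightarrow> g (letter_Suc p) = commutator G (f t) (g p)"
    and stop: "\<And>p. letter_base p \<noteq> t \<Longrightarrow> k \<le> letter_depth p \<Longrightarrow> g p \<in> N k"
  shows "word_eval G f w \<otimes>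
    inv (word_eval G g (elim_letter k t w) \<otimes> word_eval G f (filter (\<lambda>a. fst a = t) w)) \<in> N k"
proof -
  interpret N: normal "N k" G by (rule N_normal)
  let ?Q = "G Mod N k" and ?q = "\<lambda>a. N k #> a"
  interpret Q: group ?Q by (rule N.factorgroup_is_group)
  have q: "group_hom G ?Q ?q" by unfold_locales (rule N.r_coset_hom_Mod)
  interpret q: group_hom G ?Q ?q by (rule q)
  have c [simp]: "f s \<in> carrier G" "g s \<in> carrier G" for s using f g by auto
  let ?u = "elim_letter k t w" and ?v = "filter (\<lambda>a. fst a = t) w"
  have "word_eval ?Q (\<lambda>s. ?q (f s)) w =
    word_eval ?Q (\<lambda>s. ?q (g s)) ?u \<otimes>\<^bsub>?Q\<^esub> word_eval ?Q (\<lambda>s. ?q (f s)) ?v"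
  proof (rule Q.word_eval_elim_letter)
    show "range (\<lambda>s. ?q (f s)) \<subseteq> carrier ?Q" "range (\<lambda>s. ?q (g s)) \<subseteq> carrier ?Q"
      using c q.hom_closed by blast+
    show "?q (g (letter_Suc p)) = commutator ?Q (?q (f t)) (?q (g p))" if "letter_base p \<noteq> t" for p
      using step[OF that] group_hom_commutator[OF q c(1) c(2)] by simp
    show "?q (g p) = \<one>\<^bsub>?Q\<^esub>" if "letter_base p \<noteq> t" "k \<le> letter_depth p" for p
      using stop[OF that] by (simp add: N.rcos_const)
  qed (use base in auto)
  then have "?q (word_eval G f w) = ?q (word_eval G g ?u) \<otimes>\<^bsub>?Q\<^esub> ?q (word_eval G f ?v)"
    using hom_word_eval[OF q f] hom_word_eval[OF q g] by simp
  also have "\<dots> = ?q (word_eval G g ?u \<otimes> word_eval G f ?v)"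
    using f g q.hom_mult by simp
  finally have "?q (word_eval G f w) = ?q (word_eval G g ?u \<otimes> word_eval G f ?v)" .
  moreover have "word_eval G f w \<in> ?q (word_eval G f w)"
    using f by (intro rcos_self N.subgroup_axioms) simp
  ultimately have "word_eval G f w \<in> ?q (word_eval G g ?u \<otimes> word_eval G f ?v)" by simp
  then obtain n where "n \<in> N k" "word_eval G f w = n \<otimes> (word_eval G g ?u \<otimes> word_eval G f ?v)"
    by (auto simp: r_coset_def)
  then show ?thesis using f g N_carrier by (simp add: word_simps)
qed


section \<open>Noncommutative power series\<close>

text \<open>The value at a list is the coefficient of that noncommutative monomial. Infinite support
  is allowed, as inverses of 1 + X are infinite series.\<close>

type_synonym series = "nat list \<Rightarrow> int"

lemmas series_apply = plus_fun_apply minus_apply uminus_apply zero_fun_apply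

declare series_apply [simp del]

definition series_group :: "series monoid" where
  "series_group = \<lparr>carrier = UNIV, monoid.mult = (+), one = 0\<rparr>"

lemma series_group_simps [simp]:
  "carrier series_group = UNIV" "f \<otimes>\<^bsub>series_group\<^esub> g = f + g" "\<one>\<^bsub>series_group\<^esub> = 0"
  by (simp_all add: series_group_def)

lemma group_series_group: "group series_group"
  by (rule groupI) (auto simp: add.assoc intro: exI[of _ "- f" for f])

interpretation S: group series_group
  by (rule group_series_group)

lemma inv_series [simp]: "inv\<^bsub>series_group\<^esub> f = - f"
  by (rule S.inv_equality) auto

definition word_weight :: "(nat \<Rightarrow> nat) \<Rightarrow> nat list \<Rightarrow> nat" where
  "word_weight wt v = sum_list (map wt v)"

lemma word_weight_simps [simp]:
  "word_weight wt [] = 0" "word_weight wt (s # v) = wt s + word_weight wt v"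
  "word_weight wt (u @ v) = word_weight wt u + word_weight wt v"
  by (simp_all add: word_weight_def)

text \<open>The index is shifted by one, as a central filtration starts with the whole group
  in degree one.\<close>

definition series_filt :: "(nat \<Rightarrow> nat) \<Rightarrow> nat \<Rightarrow> series set" where
  "series_filt wt l = {f. \<forall>v. word_weight wt v + 1 < l \<longrightarrow> f v = 0}"

lemma series_filt_central: "central_filtration series_group (series_filt wt)"
proof (rule central_filtration.intro[OF group_series_group central_filtration_axioms.intro])
  show "subgroup (series_filt wt k) series_group" for k
    by (rule S.subgroupI) (auto simp: series_filt_def series_apply intro: exI[of _ 0])
qed (auto simp: series_filt_def commutator_def series_apply)

interpretation SF: central_filtration series_group "series_filt wt" for wt
  by (rule series_filt_central)

lemma series_filt_add: "f \<in> series_filt wt l \<Longrightarrow> g \<in> series_filt wt l \<Longrightarrow> f + g \<in> series_filt wt l"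
  and series_filt_diff: "f \<in> series_filt wt l \<Longrightarrow> g \<in> series_filt wt l \<Longrightarrow> f - g \<in> series_filt wt l"
  and series_filt_uminus: "f \<in> series_filt wt l \<Longrightarrow> - f \<in> series_filt wt l"
  and series_filt_0: "0 \<in> series_filt wt l"
  by (auto simp: series_filt_def series_apply)

lemma series_filt_1: "series_filt wt (Suc 0) = UNIV"
  by (simp add: series_filt_def)

section \<open>Unipotent operators on power series\<close>

abbreviation unip :: "(nat \<Rightarrow> nat) \<Rightarrow> nat \<Rightarrow> (series \<Rightarrow> series) set" where
  "unip wt \<equiv> stabiliser series_group (series_filt wt)"

text \<open>Only additivity is imposed, so that left multiplications and substitutions of variables
  live in one group.\<close>

abbreviation unip_group :: "(nat \<Rightarrow> nat) \<Rightarrow> (series \<Rightarrow> series) monoid" where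
  "unip_group wt \<equiv> stabiliser_group series_group (series_filt wt)"

interpretation U: central_filtration "unip_group wt" "unip wt" for wt
  by (rule SF.stabiliser_filtration)

lemma unip_add:
  assumes "\<sigma> \<in> unip wt k" shows "\<sigma> (f + g) = \<sigma> f + \<sigma> g"
  using auto_mult[OF SF.stabiliser_auto[OF assms], of f g] by simp

lemma unip_diff:
  assumes "\<sigma> \<in> unip wt k" shows "\<sigma> (f - g) = \<sigma> f - \<sigma> g"
  using unip_add[OF assms, of "f - g" g] by (simp add: algebra_simps)

lemma unip_step:
  assumes "\<sigma> \<in> unip wt k" "f \<in> series_filt wt l" shows "\<sigma> f - f \<in> series_filt wt (l + max 1 k)"
  using SF.stabiliser_step[OF assms] by simp

lemma unip_step':
  assumes "\<sigma> \<in> unip wt k" "f \<in> series_filt wt l" shows "\<sigma> f - f \<in> series_filt wt (l + k)"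
  using unip_step[OF assms] SF.N_antimono[of "l + k" "l + max 1 k" wt] by auto

lemma unip_1: "\<sigma> \<in> unip wt k \<Longrightarrow> \<sigma> \<in> unip wt (Suc 0)"
  using U.N_carrier by simp

lemma unip_mult:
  assumes "\<sigma> \<in> unip wt (Suc 0)" "\<tau> \<in> unip wt (Suc 0)"
  shows "(\<sigma> \<otimes>\<^bsub>unip_group wt\<^esub> \<tau>) f = \<sigma> (\<tau> f)"
  using assms[THEN SF.stabiliser_auto] by (simp add: S.AutoGroup_mult compose_def)

lemma unip_one: "\<one>\<^bsub>unip_group wt\<^esub> f = f"
  by (simp add: S.AutoGroup_one)

lemma unip_inv:
  assumes "\<sigma> \<in> unip wt (Suc 0)"
  shows "\<sigma> ((inv\<^bsub>unip_group wt\<^esub> \<sigma>) f) = f" "(inv\<^bsub>unip_group wt\<^esub> \<sigma>) (\<sigma> f) = f"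
    "inv\<^bsub>unip_group wt\<^esub> \<sigma> \<in> unip wt (Suc 0)"
proof -
  have i: "inv\<^bsub>unip_group wt\<^esub> \<sigma> \<in> unip wt (Suc 0)" using U.inv_closed[of \<sigma> wt] assms by simp
  then show "inv\<^bsub>unip_group wt\<^esub> \<sigma> \<in> unip wt (Suc 0)" .
  show "\<sigma> ((inv\<^bsub>unip_group wt\<^esub> \<sigma>) f) = f" "(inv\<^bsub>unip_group wt\<^esub> \<sigma>) (\<sigma> f) = f"
    using U.r_inv[of \<sigma> wt] U.l_inv[of \<sigma> wt] assms unip_mult[OF assms i, of f]
      unip_mult[OF i assms, of f] unip_one[of wt f] by simp_all
qed

text \<open>Bijectivity comes from the shift: a kernel element lies in every term of the filtration,
  hence is 0, and g f = y is solved by successive approximation.\<close>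

lemma unipI:
  assumes add: "\<And>f h. g (f + h) = g f + g h"
    and step: "\<And>l f. f \<in> series_filt wt l \<Longrightarrow> g f - f \<in> series_filt wt (l + e)" and e: "1 \<le> e"
  shows "g \<in> unip wt e"
proof -
  have diff: "g (f - h) = g f - g h" for f h using add[of "f - h" h] by (simp add: algebra_simps)
  have step1: "g f - f \<in> series_filt wt (Suc l)" if "f \<in> series_filt wt l" for f l
    using step[OF that] SF.N_antimono[of "Suc l" "l + e" wt] e by auto
  have pres: "g f \<in> series_filt wt l" if "f \<in> series_filt wt l" for f l
    using series_filt_add[OF that, of "g f - f"] step1[OF that] SF.N_Suc by auto
  have zero: "f = 0" if "\<And>l. f \<in> series_filt wt l" for f
  proof
    show "f v = 0 v" for v using that[of "word_weight wt v + 2"] by (simp add: series_filt_def series_apply)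
  qed
  have "inj g"
  proof (rule injI)
    fix f h assume "g f = g h"
    then have 0: "g (f - h) = 0" by (simp add: diff)
    have "f - h \<in> series_filt wt l" for l
    proof (induction l)
      case 0
      then show ?case by (simp add: series_filt_def)
    next
      case (Suc l)
      from series_filt_diff[OF series_filt_0 step1[OF Suc]] 0 show ?case by simp
    qed
    from zero[OF this] show "f = h" by simp
  qed
  moreover have "surj g"
  proof -
    have "\<exists>f. g f = y" for y
    proof -
    \<comment> \<open>Correcting an approximate solution by its own error moves the error up the
      filtration.\<close>
    define a where "a = rec_nat (0 :: series) (\<lambda>n x. x + (y - g x))"
    have a_Suc: "a (Suc n) = a n + (y - g (a n))" for n by (simp add: a_def)
    have r: "y - g (a n) \<in> series_filt wt (Suc n)" for n
    proof (induction n)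
      case 0
      then show ?case by (simp add: series_filt_1)
    next
      case (Suc n)
      have "y - g (a (Suc n)) = 0 - (g (y - g (a n)) - (y - g (a n)))"
        by (simp add: a_Suc add diff)
      then show ?case by (simp only: series_filt_diff[OF series_filt_0 step1[OF Suc]])
    qed
    \<comment> \<open>From stage \<open>word_weight wt v + 1\<close> on, the error vanishes at v, so
      this coefficient no longer changes.\<close>
    define f where "f v = a (word_weight wt v + 1) v" for v
    have stable: "a (word_weight wt v + 1 + n) v = f v" for v n
    proof (induction n)
      case (Suc n)
      then show ?case using r[of "word_weight wt v + 1 + n"] by (simp add: a_Suc series_filt_def series_apply)
    qed (simp add: f_def)
    have "f - a n \<in> series_filt wt (Suc n)" for n
    proof -
      have "f v = a n v" if "word_weight wt v + 1 < Suc n" for v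
        using stable[of v "n - (word_weight wt v + 1)"] that by simp
      then show ?thesis by (simp add: series_filt_def series_apply)
    qed
    then have "g (f - a n) - (y - g (a n)) \<in> series_filt wt (Suc n)" for n
      using pres r series_filt_diff by blast
    then have "g f - y \<in> series_filt wt (Suc n)" for n by (simp add: diff algebra_simps)
    then have "g f - y \<in> series_filt wt l" for l using SF.N_Suc by blast
    from zero[OF this] show "\<exists>f. g f = y" by (auto simp: algebra_simps)
    qed
    then show ?thesis by (metis surj_def)
  qed
  ultimately have "g \<in> auto series_group"
    by (auto simp: auto_def hom_def Bij_def bij_def add)
  then show ?thesis using step e by (simp add: stabiliser_def max_def)
qed

section \<open>Left multiplications and the Magnus expansion\<close>

fun lmult :: "nat \<Rightarrow> series \<Rightarrow> series" where
  "lmult s f [] = 0"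
| "lmult s f (q # v) = (if q = s then f v else 0)"

text \<open>Left multiplication by 1 + X_s, \<open>lmult s\<close> being left multiplication by
  X_s.\<close>

definition lshift :: "nat \<Rightarrow> series \<Rightarrow> series" where
  "lshift s f = f + lmult s f"

definition series_one :: series where
  "series_one v = (if v = [] then 1 else 0)"

lemma lmult_add: "lmult s (f + g) = lmult s f + lmult s g"
proof
  show "lmult s (f + g) v = (lmult s f + lmult s g) v" for v by (cases v) (auto simp: series_apply)
qed

lemma lshift_unip:
  assumes "1 \<le> wt s" shows "lshift s \<in> unip wt (wt s)"
proof (rule unipI[OF _ _ assms])
  show "lshift s (f + h) = lshift s f + lshift s h" for f h
    by (simp add: lshift_def lmult_add)
  show "lshift s f - f \<in> series_filt wt (l + wt s)" if "f \<in> series_filt wt l" for f l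
  proof -
    have "lmult s f v = 0" if "word_weight wt v + 1 < l + wt s" for v
      using that \<open>f \<in> series_filt wt l\<close> by (cases v) (auto simp: series_filt_def)
    then show ?thesis by (simp add: lshift_def series_filt_def series_apply)
  qed
qed

lemma word_eval_unip_Cons:
  assumes "range \<rho> \<subseteq> unip wt (Suc 0)"
  shows "word_eval (unip_group wt) \<rho> (a # w) f =
    (if snd a then \<rho> (fst a) (word_eval (unip_group wt) \<rho> w f)
     else (inv\<^bsub>unip_group wt\<^esub> \<rho> (fst a)) (word_eval (unip_group wt) \<rho> w f))"
proof -
  have "\<rho> (fst a) \<in> unip wt (Suc 0)" "word_eval (unip_group wt) \<rho> w \<in> unip wt (Suc 0)"
    using assms U.word_eval_closed[of \<rho> wt w] by auto
  then show ?thesis using unip_mult[of _ wt] unip_inv(3)[of _ wt] by simp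
qed

text \<open>To prove a property of the action of a word it suffices to treat the letters; an inverse
  letter is dealt with by writing the argument as an image.\<close>

lemma word_eval_unip_induct [consumes 1, case_names Nil letter inverse]:
  assumes \<rho>: "range \<rho> \<subseteq> unip wt (Suc 0)"
    and "P [] f"
    and "\<And>s w h. \<lbrakk>P w h; h = word_eval (unip_group wt) \<rho> w f\<rbrakk> \<Longrightarrow> P ((s, True) # w) (\<rho> s h)"
    and "\<And>s w h. \<lbrakk>P w (\<rho> s h); \<rho> s h = word_eval (unip_group wt) \<rho> w f\<rbrakk> \<Longrightarrow> P ((s, False) # w) h"
  shows "P w (word_eval (unip_group wt) \<rho> w f)"
proof (induction w)
  case Nil
  then show ?case using assms(2) unip_one by simp
next
  case (Cons a w)
  obtain s b where a: "a = (s, b)" by (cases a)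
  have "\<rho> s \<in> unip wt (Suc 0)" using \<rho> by auto
  then show ?case
    using assms(3)[OF Cons refl, of s] assms(4)[of w s "(inv\<^bsub>unip_group wt\<^esub> \<rho> s) (word_eval (unip_group wt) \<rho> w f)"] Cons
      unip_inv(1) word_eval_unip_Cons[OF \<rho>, of a w f] a
    by (cases b) simp_all
qed

text \<open>Left multiplication by the Magnus expansion of the word; its value at
  \<open>series_one\<close> is the expansion itself. The weights enter through the group in which
  inverses are formed.\<close>

abbreviation magnus :: "(nat \<Rightarrow> nat) \<Rightarrow> letter list \<Rightarrow> series \<Rightarrow> series" where
  "magnus wt \<equiv> word_eval (unip_group wt) lshift"

lemma range_lshift: "(\<And>s. 1 \<le> wt s) \<Longrightarrow> range lshift \<subseteq> unip wt (Suc 0)"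
  using lshift_unip unip_1 by blast

lemma magnus_Nil:
  assumes "\<And>s. 1 \<le> wt s" shows "magnus wt w f [] = f []"
  using range_lshift[OF assms] by (induction rule: word_eval_unip_induct) (auto simp: lshift_def series_apply)

fun exponent :: "nat \<Rightarrow> letter list \<Rightarrow> int" where
  "exponent t [] = 0"
| "exponent t (a # w) = (if fst a = t then if snd a then 1 else - 1 else 0) + exponent t w"

text \<open>Serves to show that a letter to be eliminated has exponent sum 0.\<close>

lemma magnus_singleton:
  assumes "\<And>s. 1 \<le> wt s" shows "magnus wt w series_one [t] = exponent t w"
proof -
  have "magnus wt w series_one [] = 1 \<and> magnus wt w series_one [t] = exponent t w"
    using range_lshift[OF assms]
    by (induction rule: word_eval_unip_induct) (auto simp: lshift_def series_one_def series_apply split: if_splits)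
  then show ?thesis by simp
qed

lemma (in group) word_eval_filter:
  assumes "range f \<subseteq> carrier G"
  shows "word_eval G f (filter (\<lambda>a. fst a = t) w) = f t [^] exponent t w"
proof (induction w)
  case (Cons a w)
  have "f t \<in> carrier G" using assms by auto
  then show ?case using Cons by (auto simp: int_pow_mult int_pow_neg int_pow_diff)
qed simp

subsection \<open>The power series control every filtered action\<close>

text \<open>The monomial v evaluated at X_s = \<rho> s - 1 and applied to y.\<close>

fun diff_op :: "(nat \<Rightarrow> series \<Rightarrow> series) \<Rightarrow> nat list \<Rightarrow> series \<Rightarrow> series" where
  "diff_op \<rho> [] y = y"
| "diff_op \<rho> (s # v) y = \<rho> s (diff_op \<rho> v y) - diff_op \<rho> v y"

definition scale :: "int \<Rightarrow> series \<Rightarrow> series" where "scale c f = (\<lambda>v. c * f v)"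

lemma unip_scale:
  assumes "\<sigma> \<in> unip wt k" shows "\<sigma> (scale c f) = scale c (\<sigma> f)"
proof (induction c rule: int_induct[where k = 0])
  case base
  have "scale 0 g = g - g" for g by (auto simp: scale_def series_apply)
  then show ?case using unip_diff[OF assms] by metis
next
  case (step1 i)
  have "scale (i + 1) g = scale i g + g" for g by (auto simp: scale_def algebra_simps series_apply)
  then show ?case using step1 unip_add[OF assms] by metis
next
  case (step2 i)
  have "scale (i - 1) g = scale i g - g" for g by (auto simp: scale_def algebra_simps series_apply)
  then show ?case using step2 unip_diff[OF assms] by metis
qed

lemma unip_sum:
  assumes "\<sigma> \<in> unip wt k" shows "\<sigma> (sum h V) = (\<Sum>v\<in>V. \<sigma> (h v))"
proof (induction V rule: infinite_finite_induct)
  case (insert v V)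
  then show ?case using unip_add[OF assms] by simp
qed (use unip_diff[OF assms, of 0 0] in simp_all)

lemma scale_filt: "f \<in> series_filt wt l \<Longrightarrow> scale c f \<in> series_filt wt l"
  by (simp add: series_filt_def scale_def)

lemma sum_filt: "(\<And>v. v \<in> V \<Longrightarrow> h v \<in> series_filt wt l) \<Longrightarrow> sum h V \<in> series_filt wt l"
  by (induction V rule: infinite_finite_induct) (auto simp: series_filt_0 series_filt_add)

lemma finite_word_weight:
  assumes wt: "\<And>s. 1 \<le> wt s" and fin: "finite {s. wt s < k}"
  shows "finite {v. word_weight wt v < k}"
proof (rule finite_subset)
  have len: "length v \<le> word_weight wt v" for v
  proof (induction v)
    case (Cons s v)
    then show ?case using wt[of s] by simp
  qed simp
  have letter: "s \<in> set v \<Longrightarrow> wt s \<le> word_weight wt v" for s v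
    by (induction v) auto
  show "{v. word_weight wt v < k} \<subseteq> {v. set v \<subseteq> {s. wt s < k} \<and> length v \<le> k}"
  proof clarify
    fix v assume "word_weight wt v < k"
    then show "set v \<subseteq> {s. wt s < k} \<and> length v \<le> k"
      using len[of v] letter[of _ v] by fastforce
  qed
  show "finite {v. set v \<subseteq> {s. wt s < k} \<and> length v \<le> k}"
    using finite_lists_length_le[OF fin] .
qed

text \<open>Substituting X_s = \<rho> s - 1 turns the Magnus expansion of a word into the operator
  by which it acts. Monomials of weight at least \<open>k\<close> send \<open>y\<close> into degree
  \<open>Suc k\<close>, so an expansion that is 1 below weight \<open>k\<close> makes the word fix
  \<open>y\<close> to that precision.\<close>

lemma word_eval_unip_fixes:
  assumes wt: "\<And>s. 1 \<le> wt s" and fin: "finite {s. wt s < k}"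
    and \<rho>: "\<And>s. \<rho> s \<in> unip wt' (wt s)"
    and w: "magnus wt w series_one - series_one \<in> series_filt wt (Suc k)"
  shows "word_eval (unip_group wt') \<rho> w y - y \<in> series_filt wt' (Suc k)"
proof (cases "k = 0")
  case True
  then show ?thesis by (simp add: series_filt_1)
next
  case False
  define V where "V = {v. word_weight wt v < k}"
  have V: "finite V" unfolding V_def using finite_word_weight[OF wt fin] .
  define D where "D v = diff_op \<rho> v y" for v
  \<comment> \<open>The substitution evaluated at \<open>y\<close>, cut off below weight
    \<open>k\<close> so that the sum is finite.\<close>
  define \<Phi> where "\<Phi> f = (\<Sum>v\<in>V. scale (f v) (D v))" for f :: series
  note \<rho>1 = unip_1[OF \<rho>]
  have D: "D v \<in> series_filt wt' (Suc (word_weight wt v))" for v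
  proof (induction v)
    case (Cons s v)
    from unip_step'[OF \<rho>[of s] Cons] show ?case by (simp add: D_def add.commute)
  qed (simp add: series_filt_1)
  have \<Phi>_add: "\<Phi> (f + g) = \<Phi> f + \<Phi> g" for f g
    unfolding \<Phi>_def sum.distrib[symmetric]
    by (rule sum.cong) (auto simp: scale_def algebra_simps series_apply)
  have \<Phi>_lmult: "\<Phi> (lmult s f) = (\<Sum>u\<in>V. if s # u \<in> V then scale (f u) (D (s # u)) else 0)" for s f
  proof -
    have "\<Phi> (lmult s f) = (\<Sum>v\<in>(#) s ` {u. s # u \<in> V}. scale (lmult s f v) (D v))"
      unfolding \<Phi>_def
    proof (rule sum.mono_neutral_right[OF V])
      show "\<forall>v\<in>V - (#) s ` {u. s # u \<in> V}. scale (lmult s f v) (D v) = 0"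
      proof
        fix v assume "v \<in> V - (#) s ` {u. s # u \<in> V}"
        then have "lmult s f v = 0" by (cases v) auto
        then show "scale (lmult s f v) (D v) = 0" by (auto simp: scale_def series_apply)
      qed
    qed auto
    also have "\<dots> = (\<Sum>u\<in>{u. s # u \<in> V}. scale (f u) (D (s # u)))"
      by (subst sum.reindex) auto
    also have "\<dots> = (\<Sum>u\<in>V. if s # u \<in> V then scale (f u) (D (s # u)) else 0)"
      using V by (subst sum.inter_filter[symmetric]) (auto intro!: sum.cong simp: V_def)
    finally show ?thesis .
  qed
  \<comment> \<open>Exact intertwining fails only at monomials \<open>s # u\<close> that leave
    \<open>V\<close>; their weight is at least \<open>k\<close>, so the error is negligible.\<close>
  have \<Phi>_lshift: "\<Phi> (lshift s f) - \<rho> s (\<Phi> f) \<in> series_filt wt' (Suc k)" for s f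
  proof -
    have "\<rho> s (\<Phi> f) - \<Phi> f = (\<Sum>u\<in>V. scale (f u) (D (s # u)))"
      unfolding \<Phi>_def unip_sum[OF \<rho>] sum_subtractf[symmetric] unip_scale[OF \<rho>]
      by (rule sum.cong) (auto simp: scale_def D_def algebra_simps series_apply)
    then have "\<Phi> (lshift s f) - \<rho> s (\<Phi> f) =
      (\<Sum>u\<in>V. (if s # u \<in> V then scale (f u) (D (s # u)) else 0) - scale (f u) (D (s # u)))"
      unfolding lshift_def \<Phi>_add \<Phi>_lmult sum_subtractf by (simp add: algebra_simps)
    also have "\<dots> \<in> series_filt wt' (Suc k)"
    proof (rule sum_filt)
      fix u
      have "D (s # u) \<in> series_filt wt' (Suc k)" if "s # u \<notin> V"
        using D[of "s # u"] that SF.N_antimono[of "Suc k" "Suc (word_weight wt (s # u))" wt']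
        by (auto simp: V_def)
      then show "(if s # u \<in> V then scale (f u) (D (s # u)) else 0) - scale (f u) (D (s # u))
          \<in> series_filt wt' (Suc k)"
        by (auto intro: series_filt_uminus series_filt_0 scale_filt)
    qed
    finally show ?thesis .
  qed
  have \<rho>_pres: "\<sigma> f - \<sigma> g \<in> series_filt wt' (Suc k)"
    if "f - g \<in> series_filt wt' (Suc k)" "\<sigma> \<in> unip wt' (Suc 0)" for \<sigma> f g
    using SF.stabiliser_preserves[OF that(2,1)] unip_diff[OF that(2)] by simp
  have "\<Phi> (magnus wt w f) - word_eval (unip_group wt') \<rho> w (\<Phi> f) \<in> series_filt wt' (Suc k)" for f
    using range_lshift[OF wt]
  proof (induction rule: word_eval_unip_induct)
    case Nil
    then show ?case using series_filt_0 unip_one by simp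
  next
    case (letter s w h)
    then have "\<rho> s (\<Phi> h) - \<rho> s (word_eval (unip_group wt') \<rho> w (\<Phi> f)) \<in> series_filt wt' (Suc k)"
      using \<rho>_pres \<rho>1 by blast
    from series_filt_add[OF \<Phi>_lshift[of s h] this] show ?case
      using \<rho>1 by (subst word_eval_unip_Cons) (auto simp: algebra_simps)
  next
    case (inverse s w h)
    let ?i = "inv\<^bsub>unip_group wt'\<^esub> \<rho> s" and ?y = "word_eval (unip_group wt') \<rho> w (\<Phi> f)"
    have "\<rho> s (\<Phi> h) - ?y \<in> series_filt wt' (Suc k)"
      using series_filt_diff[OF inverse(1) \<Phi>_lshift[of s h]] by (simp add: algebra_simps)
    from \<rho>_pres[OF this unip_inv(3)[OF \<rho>1[of s]]] have "\<Phi> h - ?i ?y \<in> series_filt wt' (Suc k)"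
      using unip_inv(2)[OF \<rho>1[of s]] by simp
    then show ?case
      using \<rho>1 by (subst word_eval_unip_Cons) auto
  qed
  note act = this[of series_one]
  have \<Phi>_one: "\<Phi> series_one = y"
  proof -
    have "\<Phi> series_one = (\<Sum>v\<in>{[]}. scale (series_one v) (D v))"
      unfolding \<Phi>_def
      by (rule sum.mono_neutral_right[OF V]) (use False in \<open>auto simp: V_def series_one_def scale_def series_apply\<close>)
    then show ?thesis by (simp add: scale_def series_one_def D_def)
  qed
  have "\<Phi> (magnus wt w series_one) = \<Phi> series_one"
    unfolding \<Phi>_def
  proof (rule sum.cong[OF refl])
    fix v assume "v \<in> V"
    then have "word_weight wt v + 1 < Suc k" by (simp add: V_def)
    with w have "(magnus wt w series_one - series_one) v = 0"
      unfolding series_filt_def by blast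
    then have "magnus wt w series_one v = series_one v" unfolding minus_apply by linarith
    then show "scale (magnus wt w series_one v) (D v) = scale (series_one v) (D v)"
      by (simp only:)
  qed
  with act have "y - word_eval (unip_group wt') \<rho> w y \<in> series_filt wt' (Suc k)"
    by (simp only: \<Phi>_one)
  from series_filt_uminus[OF this] show ?thesis by (simp only: minus_diff_eq)
qed


section \<open>Magnus' theorem by elimination\<close>

definition letter_pred :: "nat \<Rightarrow> nat" where
  "letter_pred q = prod_encode (letter_base q, letter_depth q - 1)"

lemma letter_pred_Suc [simp]: "letter_pred (letter_Suc p) = p"
  by (simp add: letter_pred_def) (simp add: letter_base_def letter_depth_def)

lemma letter_Suc_pred: "letter_depth q \<noteq> 0 \<Longrightarrow> letter_Suc (letter_pred q) = q"
  by (simp add: letter_Suc_def letter_pred_def) (simp add: letter_base_def letter_depth_def)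

text \<open>The algebra endomorphism \<open>X\<^sub>p \<mapsto> X\<^sub>p + X\<^sub>q + X\<^sub>q X\<^sub>p\<close> with \<open>q = letter_Suc p\<close>; in other words
  \<open>1 + X\<^sub>p \<mapsto> (1 + X\<^sub>q) (1 + X\<^sub>p)\<close>, which is the conjugation action of the eliminated letter.\<close>

fun twist :: "series \<Rightarrow> nat list \<Rightarrow> int" where
  "twist f [] = f []"
| "twist f (q # v) = twist (\<lambda>u. f (q # u)) v +
    (if letter_depth q = 0 then 0
     else twist (\<lambda>u. f (letter_pred q # u)) v +
       (case v of [] \<Rightarrow> 0 | r # v' \<Rightarrow>
         if r = letter_pred q then twist (\<lambda>u. f (letter_pred q # u)) v' else 0))"

lemma twist_add: "twist (f + g) = twist f + twist g"
proof
  fix v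
  show "twist (f + g) v = (twist f + twist g) v"
  proof (induction v arbitrary: f g rule: length_induct)
    case (1 v)
    have *: "(\<lambda>u. (f + g) (q # u)) = (\<lambda>u. f (q # u)) + (\<lambda>u. g (q # u))" for q
      by (rule ext) (simp add: series_apply)
    show ?case
    proof (cases v)
      case (Cons q v')
      have "twist (f + g) u = (twist f + twist g) u" if "length u < length v" for u f g
        using 1 that by blast
      then have IH: "twist (\<lambda>u. (f + g) (q # u)) u = twist (\<lambda>u. f (q # u)) u + twist (\<lambda>u. g (q # u)) u"
        if "length u < length v" for u q
        unfolding * plus_fun_apply[of "twist h" for h, symmetric] using that by blast
      show ?thesis
        unfolding Cons plus_fun_apply[of "twist f" "twist g"] twist.simps(2)[of _ q v']
        by (cases v') (simp_all add: IH Cons del: twist.simps)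
    qed (simp add: series_apply)
  qed
qed

lemma twist_0: "twist 0 = 0"
  using twist_add[of 0 0] by simp

text \<open>Multiplicativity of the substitution for a left factor X_p; the three summands form the
  image of X_p. On coefficients, \<open>letter_Suc p\<close> is recognised as the letter of positive
  depth with predecessor p.\<close>

lemma twist_lmult:
  "twist (lmult p f) = lmult p (twist f) + lmult (letter_Suc p) (twist f)
     + lmult (letter_Suc p) (lmult p (twist f))"
proof
  fix v
  have *: "(\<lambda>u. lmult p f (q # u)) = (if q = p then f else 0)" for q
    by (rule ext) (simp add: series_apply)
  have tw: "twist (if b then f else 0) u = (if b then twist f u else 0)" for b u
    by (simp add: twist_0 zero_fun_apply)
  have **: "letter_depth q \<noteq> 0 \<and> letter_pred q = p \<longleftrightarrow> q = letter_Suc p" for q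
    using letter_Suc_pred by auto
  show "twist (lmult p f) v = (lmult p (twist f) + lmult (letter_Suc p) (twist f)
     + lmult (letter_Suc p) (lmult p (twist f))) v"
  proof (cases v)
    case (Cons q v')
    have "twist (lmult p f) v = (if q = p then twist f v' else 0) +
        (if letter_depth q \<noteq> 0 \<and> letter_pred q = p then
          twist f v' + (case v' of [] \<Rightarrow> 0 | r # v' \<Rightarrow> if r = p then twist f v' else 0) else 0)"
      unfolding Cons twist.simps(2) * tw by (cases v') simp_all
    then show ?thesis unfolding ** using Cons by (cases v') (auto simp: series_apply)
  qed (simp add: series_apply)
qed

text \<open>As operators, t (1 + X_p) t^-1 = (1 + X_q) (1 + X_p) with q =
  \<open>letter_Suc p\<close>: the commutator of t and p acts as the letter q.\<close>

lemma twist_lshift: "twist (lshift p f) = lshift (letter_Suc p) (lshift p (twist f))"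
  by (simp add: lshift_def twist_add twist_lmult lmult_add add.assoc)

lemma twist_one: "twist series_one = series_one"
proof
  fix v
  have "(\<lambda>u. series_one (q # u)) = 0" for q
    by (rule ext) (simp add: series_one_def series_apply)
  then show "twist series_one v = series_one v"
    by (cases v) (auto simp: twist_0 series_apply series_one_def split: list.split)
qed

text \<open>Both terms added to X_p contain the variable of \<open>letter_Suc p\<close>, so each
  replacement raises the weight by at least \<open>d\<close>. Induction is on length because the
  recursion may remove two letters.\<close>

lemma twist_filt:
  assumes d: "\<And>p. wt (letter_Suc p) = wt p + d"
    and "\<And>u. word_weight wt u < l \<Longrightarrow> f u = 0" and "word_weight wt v < l + d"
  shows "twist f v = f v"
  using assms(2,3)
proof (induction v arbitrary: f l rule: length_induct)
  case (1 v)
  show ?case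
  proof (cases v)
    case (Cons q v')
    have IH: "twist g u = g u"
      if "length u < length v" "\<And>u. word_weight wt u < m \<Longrightarrow> g u = 0" "word_weight wt u < m + d" for g u m
      using 1(1) that by blast
    have main: "twist (\<lambda>u. f (q # u)) v' = f (q # v')"
    proof (rule IH[of _ "l - wt q"])
      show "f (q # u) = 0" if "word_weight wt u < l - wt q" for u
        using that 1(2)[of "q # u"] by simp
    qed (use Cons 1(3) in auto)
    have rest: "twist (\<lambda>u. f (letter_pred q # u)) u = 0"
      if q: "letter_depth q \<noteq> 0" and u: "length u \<le> length v'" "word_weight wt u \<le> word_weight wt v'" for u
    proof -
      let ?p = "letter_pred q"
      have wq: "wt q = wt ?p + d" using d[of ?p] letter_Suc_pred[OF q] by simp
      have "twist (\<lambda>u. f (?p # u)) u = f (?p # u)"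
      proof (rule IH[of _ "l - wt ?p"])
        show "f (?p # u) = 0" if "word_weight wt u < l - wt ?p" for u
          using that 1(2)[of "?p # u"] by simp
      qed (use Cons 1(3) u wq in auto)
      moreover have "f (?p # u) = 0"
        using 1(2)[of "?p # u"] 1(3) Cons u wq by simp
      ultimately show ?thesis by simp
    qed
    show ?thesis
      using Cons main rest by (auto split: list.split)
  qed simp
qed

lemma twist_unip:
  assumes d: "\<And>p. wt (letter_Suc p) = wt p + d" and "1 \<le> d"
  shows "twist \<in> unip wt d"
proof (rule unipI[OF twist_add _ assms(2)])
  fix l f assume f: "f \<in> series_filt wt l"
  have "twist f v = f v" if "word_weight wt v + 1 < l + d" for v
    by (rule twist_filt[of wt d "l - 1", OF d]) (use f that assms(2) in \<open>auto simp: series_filt_def\<close>)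
  then show "twist f - f \<in> series_filt wt (l + d)"
    by (simp add: series_filt_def series_apply)
qed

text \<open>Letters based on \<open>t\<close> do not occur after the elimination; weight at least \<open>k\<close> makes them negligible.\<close>

definition elim_weight :: "nat \<Rightarrow> nat \<Rightarrow> (nat \<Rightarrow> nat) \<Rightarrow> nat \<Rightarrow> nat" where
  "elim_weight k t wt p =
    (if letter_base p = t then k else wt (letter_base p)) + letter_depth p * wt t"

lemma magnus_elim_letter:
  assumes wt: "\<And>s. 1 \<le> wt s" and fin: "finite {s. wt s < k}" and t: "wt t < k"
    and w: "magnus wt w series_one - series_one \<in> series_filt wt (Suc k)"
  defines "wt' \<equiv> elim_weight k t wt"
  shows "magnus wt' (elim_letter k t w) series_one - series_one \<in> series_filt wt' (Suc k)"
proof -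
  \<comment> \<open>The action on series in the new letters. \<open>twist\<close> shifts weights by
    \<open>wt t\<close> and the letter of depth 0 over s by \<open>wt s\<close>, so the old weights
    control it.\<close>
  define \<rho> where "\<rho> s = (if s = t then twist else lshift (prod_encode (s, 0)))" for s
  have wt': "1 \<le> wt' p" for p
    using wt[of "letter_base p"] wt[of t] t by (auto simp: wt'_def elim_weight_def)
  have shift: "wt' (letter_Suc p) = wt' p + wt t" for p
    by (simp add: wt'_def elim_weight_def)
  have \<rho>: "\<rho> s \<in> unip wt' (wt s)" for s
  proof (cases "s = t")
    case True
    then show ?thesis using twist_unip[of wt' "wt t", OF shift wt] by (simp add: \<rho>_def)
  next
    case False
    have "lshift (prod_encode (s, 0)) \<in> unip wt' (wt' (prod_encode (s, 0)))"
      using wt' by (rule lshift_unip)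
    then show ?thesis using False by (simp add: \<rho>_def wt'_def elim_weight_def)
  qed
  have \<rho>1: "\<rho> s \<in> unip wt' (Suc 0)" and L1: "lshift s \<in> unip wt' (Suc 0)" for s
    using unip_1[OF \<rho>] unip_1[OF lshift_unip[of wt', OF wt']] .
  have r: "range \<rho> \<subseteq> carrier (unip_group wt')" "range lshift \<subseteq> carrier (unip_group wt')"
    using \<rho>1 L1 by auto
  have r1: "range \<rho> \<subseteq> unip wt' (Suc 0)" using \<rho>1 by auto
  define u v where "u = elim_letter k t w" and "v = filter (\<lambda>a. fst a = t) w"
  let ?e = "word_eval (unip_group wt') \<rho>"
  \<comment> \<open>The error of the elimination, of degree \<open>k\<close> because letters of
    depth at least \<open>k\<close> have weight at least \<open>k\<close>.\<close>
  define \<nu> where "\<nu> = ?e w \<otimes>\<^bsub>unip_group wt'\<^esub> inv\<^bsub>unip_group wt'\<^esub> (magnus wt' u \<otimes>\<^bsub>unip_group wt'\<^esub> ?e v)"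
  have \<nu>: "\<nu> \<in> unip wt' k"
    unfolding \<nu>_def u_def v_def
  proof (rule U.word_eval_elim_letter_mod[OF r])
    show "lshift (letter_Suc p) = commutator (unip_group wt') (\<rho> t) (lshift p)" for p
    proof -
      let ?U = "unip_group wt'"
      have c: "\<rho> t \<in> carrier ?U" "lshift p \<in> carrier ?U" "lshift (letter_Suc p) \<in> carrier ?U"
        using \<rho>1 L1 by auto
      have "\<rho> t \<otimes>\<^bsub>?U\<^esub> lshift p = lshift (letter_Suc p) \<otimes>\<^bsub>?U\<^esub> (lshift p \<otimes>\<^bsub>?U\<^esub> \<rho> t)"
      proof
        fix f
        have m: "lshift p \<otimes>\<^bsub>?U\<^esub> \<rho> t \<in> unip wt' (Suc 0)" using U.m_closed[OF c(2,1)] by simp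
        show "(\<rho> t \<otimes>\<^bsub>?U\<^esub> lshift p) f = (lshift (letter_Suc p) \<otimes>\<^bsub>?U\<^esub> (lshift p \<otimes>\<^bsub>?U\<^esub> \<rho> t)) f"
          unfolding unip_mult[OF \<rho>1 L1] unip_mult[OF L1 m] unip_mult[OF L1 \<rho>1]
          using twist_lshift by (simp add: \<rho>_def)
      qed
      then have "commutator ?U (\<rho> t) (lshift p) =
        lshift (letter_Suc p) \<otimes>\<^bsub>?U\<^esub> (lshift p \<otimes>\<^bsub>?U\<^esub> \<rho> t) \<otimes>\<^bsub>?U\<^esub> inv\<^bsub>?U\<^esub> \<rho> t \<otimes>\<^bsub>?U\<^esub> inv\<^bsub>?U\<^esub> lshift p"
        by (simp only: commutator_def)
      also have "\<dots> = lshift (letter_Suc p)"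
        using c by (simp only: U.word_simps U.r_inv U.r_one U.m_closed U.inv_closed)
      finally show ?thesis ..
    qed
    show "lshift p \<in> unip wt' k" if "letter_base p \<noteq> t" "k \<le> letter_depth p" for p
    proof -
      have "k \<le> letter_depth p * wt t"
        using that(2) wt[of t] by (metis mult.commute mult_le_mono nat_mult_1)
      then have "k \<le> wt' p" by (simp add: wt'_def elim_weight_def)
      then show ?thesis using lshift_unip[of wt', OF wt'] U.N_antimono by blast
    qed
  qed (simp add: \<rho>_def)
  have e: "?e w \<in> unip wt' (Suc 0)" "?e v \<in> unip wt' (Suc 0)" "magnus wt' u \<in> unip wt' (Suc 0)"
    using U.word_eval_closed[OF r(1)] U.word_eval_closed[OF r(2)] by auto
  then have ec: "?e w \<in> carrier (unip_group wt')" "?e v \<in> carrier (unip_group wt')"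
    "magnus wt' u \<in> carrier (unip_group wt')" by auto
  have "?e w = \<nu> \<otimes>\<^bsub>unip_group wt'\<^esub> (magnus wt' u \<otimes>\<^bsub>unip_group wt'\<^esub> ?e v)"
    unfolding \<nu>_def using ec by (simp only: U.word_simps U.l_inv U.r_one U.m_closed U.inv_closed)
  moreover have m: "magnus wt' u \<otimes>\<^bsub>unip_group wt'\<^esub> ?e v \<in> unip wt' (Suc 0)"
    using U.m_closed[OF ec(3,2)] by simp
  ultimately have "?e w series_one = \<nu> (magnus wt' u (?e v series_one))"
    using unip_mult[OF unip_1[OF \<nu>] m] unip_mult[OF e(3,2)] by simp
  \<comment> \<open>\<open>v\<close> consists of letters t and their inverses, which act by
    \<open>twist\<close> or its inverse and so fix 1.\<close>
  moreover have "?e v series_one = series_one"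
  proof -
    have "(\<forall>a\<in>set v. fst a = t) \<longrightarrow> ?e v series_one = series_one" for v
      using r1
    proof (induction rule: word_eval_unip_induct)
      case (letter s w h)
      then show ?case by (auto simp: \<rho>_def twist_one)
    next
      case (inverse s w h)
      then show ?case using unip_inv(2)[OF \<rho>1[of t]] by (auto simp: \<rho>_def) (metis twist_one)
    qed simp
    then show ?thesis by (simp add: v_def)
  qed
  ultimately have "?e w series_one = \<nu> (magnus wt' u series_one)" by simp
  \<comment> \<open>Here the expansion in the old letters enters: it bounds how far \<open>w\<close>
    can move 1 in any action with these weights.\<close>
  moreover have A: "?e w series_one - series_one \<in> series_filt wt' (Suc k)"
    by (rule word_eval_unip_fixes[OF wt fin \<rho> w])
  moreover have B: "\<nu> (magnus wt' u series_one) - magnus wt' u series_one \<in> series_filt wt' (Suc k)"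
    using unip_step'[OF \<nu>, of _ "Suc 0"] by (simp add: series_filt_1)
  ultimately show ?thesis using series_filt_diff[OF A B] by (simp add: u_def)
qed

text \<open>Magnus' theorem for weighted letters, by a double induction: on the gap \<open>e\<close>
  between \<open>k\<close> and a lower bound for the weights, and on the number of letters attaining
  that bound. Eliminating such a letter lowers the number.\<close>

lemma (in central_filtration) magnus_criterion:
  assumes "\<And>s. 1 \<le> wt s" "finite {s. wt s < k}" "\<And>s. f s \<in> N (wt s)"
    and "magnus wt w series_one - series_one \<in> series_filt wt (Suc k)"
  shows "word_eval G f w \<in> N k"
proof -
  have "word_eval G f w \<in> N k"
    if "\<And>s. k \<le> wt s + e" "\<And>s. 1 \<le> wt s" "finite {s. wt s < k}" "\<And>s. f s \<in> N (wt s)"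
      "magnus wt w series_one - series_one \<in> series_filt wt (Suc k)" for e wt f w
    using that
  proof (induction e arbitrary: wt f w)
    case 0
    then show ?case using N_antimono by (intro word_eval_subgroup[OF N_subgroup]) (metis add.right_neutral subsetD)
  next
    case (Suc e)
    then show ?case
    proof (induction "card {s. wt s + Suc e = k}" arbitrary: wt f w rule: less_induct)
      case less
      note wt = less.prems(3) and fin = less.prems(4) and f = less.prems(5) and w = less.prems(6)
      show ?case
      proof (cases "\<exists>t. wt t + Suc e = k")
        case False
        then have "k \<le> wt s + e" for s using less.prems(2)[of s] by (metis add_Suc_right le_SucE)
        then show ?thesis using less.prems(1) wt fin f w by blast
      next
        case True
        then obtain t where t: "wt t + Suc e = k" ..
        then have tk: "wt t < k" by simp
        let ?wt = "elim_weight k t wt" and ?u = "elim_letter k t w"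
        \<comment> \<open>Each new letter is interpreted as the iterated commutator it stands for.
          Letters based on \<open>t\<close> have weight at least \<open>k\<close>; the value \<one>
          satisfies every degree condition.\<close>
        define g where "g p = (if letter_base p = t then \<one>
          else (commutator G (f t) ^^ letter_depth p) (f (letter_base p)))" for p
        have fc: "f s \<in> carrier G" for s using f N_carrier by blast
        have pow: "(commutator G (f t) ^^ m) (f x) \<in> N (wt x + m * wt t)" for m x
        proof (induction m)
          case (Suc m)
          have "commutator G (f t) ((commutator G (f t) ^^ m) (f x)) \<in> N (wt t + (wt x + m * wt t))"
            using N_commutator[OF _ _ f Suc] wt by (simp add: add_increasing2 trans_le_add1)
          then show ?case by (simp add: ac_simps)
        qed (simp add: f)
        have g: "g p \<in> N (?wt p)" for p
          using pow N_one by (simp add: g_def elim_weight_def)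
        then have gc: "g p \<in> carrier G" for p using N_carrier by blast
        have enc: "p = prod_encode (letter_base p, letter_depth p)" for p
          by (simp add: letter_base_def letter_depth_def)
        have wt': "1 \<le> ?wt p" for p
          using wt[of "letter_base p"] wt[of t] tk by (simp add: elim_weight_def)
        have "{p. ?wt p < k} \<subseteq> prod_encode ` ({s. wt s < k} \<times> {..<k})"
        proof
          fix p assume "p \<in> {p. ?wt p < k}"
          then have p: "letter_base p \<noteq> t" "wt (letter_base p) + letter_depth p * wt t < k"
            by (auto simp: elim_weight_def split: if_splits)
          have "letter_depth p \<le> letter_depth p * wt t"
            using mult_le_mono2[OF wt[of t], of "letter_depth p"] by (simp only: mult_1_right)
          then have "letter_depth p < k" "wt (letter_base p) < k" using p(2) by linarith+
          then show "p \<in> prod_encode ` ({s. wt s < k} \<times> {..<k})"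
            using enc[of p] by blast
        qed
        then have fin': "finite {p. ?wt p < k}" by (rule finite_subset) (use fin in auto)
        have le: "k \<le> ?wt p + Suc e" for p
          using less.prems(2)[of "letter_base p"] by (simp add: elim_weight_def)
        \<comment> \<open>Elimination creates no letter of minimal weight: each unit of depth adds
          \<open>wt t\<close> \<ge> 1, so depth 0 and a base other than \<open>t\<close> are
          forced.\<close>
        have "{p. ?wt p + Suc e = k} \<subseteq> (\<lambda>x. prod_encode (x, 0)) ` ({s. wt s + Suc e = k} - {t})"
        proof
          fix p assume "p \<in> {p. ?wt p + Suc e = k}"
          then have p: "?wt p + Suc e = k" by simp
          have b: "letter_base p \<noteq> t" using p by (auto simp: elim_weight_def)
          then have "wt (letter_base p) + letter_depth p * wt t + Suc e = k"
            using p by (simp add: elim_weight_def)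
          then have "letter_depth p * wt t = 0" "wt (letter_base p) + Suc e = k"
            using less.prems(2)[of "letter_base p"] by auto
          moreover from this have "letter_depth p = 0" using wt[of t] by simp
          ultimately show "p \<in> (\<lambda>x. prod_encode (x, 0)) ` ({s. wt s + Suc e = k} - {t})"
            using enc[of p] b by auto
        qed
        moreover have finS: "finite {s. wt s + Suc e = k}"
          by (rule finite_subset[OF _ fin]) auto
        ultimately have "card {p. ?wt p + Suc e = k} \<le> card ({s. wt s + Suc e = k} - {t})"
          by (meson card_image_le card_mono finite_Diff finite_imageI le_trans)
        also have "\<dots> < card {s. wt s + Suc e = k}"
          using t finS by (intro card_Diff1_less) auto
        finally have card: "card {p. ?wt p + Suc e = k} < card {s. wt s + Suc e = k}" .
        have u: "word_eval G g ?u \<in> N k"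
          by (rule less.hyps[OF card less.prems(1) le wt' fin' g magnus_elim_letter[OF wt fin tk w]])
        \<comment> \<open>\<open>wt t\<close> is below \<open>k\<close>, so the linear coefficient
          at \<open>t\<close> vanishes, and with it the remaining power of \<open>t\<close>.\<close>
        have "exponent t w = 0"
        proof -
          have "(magnus wt w series_one - series_one) [t] = 0"
            using w tk by (simp add: series_filt_def)
          then show ?thesis using magnus_singleton[of wt w t, OF wt] by (simp add: series_apply series_one_def)
        qed
        then have v: "word_eval G f (filter (\<lambda>a. fst a = t) w) = \<one>"
          using word_eval_filter[of f t w] fc by auto
        have "word_eval G f w \<otimes>
          inv (word_eval G g ?u \<otimes> word_eval G f (filter (\<lambda>a. fst a = t) w)) \<in> N k"
        proof (rule word_eval_elim_letter_mod)
          show "range f \<subseteq> carrier G" "range g \<subseteq> carrier G" using fc gc by auto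
          show "g p \<in> N k" if "letter_base p \<noteq> t" "k \<le> letter_depth p" for p
          proof -
            have "k \<le> letter_depth p * wt t"
              using that(2) wt[of t] by (metis mult.commute mult_le_mono nat_mult_1)
            then have "k \<le> ?wt p" by (simp add: elim_weight_def)
            then show ?thesis using g N_antimono by blast
          qed
        qed (auto simp: g_def)
        moreover have "word_eval G f w \<in> carrier G" "word_eval G g ?u \<in> carrier G"
          using fc gc by (auto intro!: word_eval_closed)
        ultimately show ?thesis using u v N_cong_mult by simp
      qed
    qed
  qed
  from this[of wt k] assms show ?thesis by simp
qed

section \<open>Centralisers of a generator modulo the lower central series\<close>

text \<open>Right multiplication by X_i; it commutes with the left multiplications by which words
  act.\<close>

definition rmult :: "nat \<Rightarrow> series \<Rightarrow> series" where
  "rmult i f v = (if v \<noteq> [] \<and> last v = i then f (butlast v) else 0)"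

lemma rmult_lshift: "rmult i (lshift s f) = lshift s (rmult i f)"
proof
  show "rmult i (lshift s f) v = lshift s (rmult i f) v" for v
    by (cases v) (auto simp: rmult_def lshift_def series_apply)
qed

lemma magnus_rmult:
  assumes wt: "\<And>s. 1 \<le> wt s"
  shows "magnus wt w (rmult i f) = rmult i (magnus wt w f)"
  using range_lshift[of wt, OF wt]
proof (induction rule: word_eval_unip_induct)
  case Nil
  then show ?case using unip_one by simp
next
  case (letter s w h)
  then show ?case
    using word_eval_unip_Cons[OF range_lshift[of wt, OF wt], where a = "(s, True)"] by (simp add: rmult_lshift)
next
  case (inverse s w h)
  have s: "lshift s \<in> unip wt (Suc 0)" using range_lshift[of wt, OF wt] by auto
  from inverse(1) have "magnus wt w (rmult i f) = lshift s (rmult i h)" by (simp only: rmult_lshift)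
  then show ?case
    by (simp only: word_eval_unip_Cons[OF range_lshift[of wt, OF wt]] snd_conv fst_conv if_False
        unip_inv(2)[OF s])
qed

text \<open>Left multiplication by 1 + X_s with s \<noteq> i creates no monomial beginning with
  X_i.\<close>

lemma magnus_avoid:
  assumes wt: "\<And>s. 1 \<le> wt s" and "i \<notin> fst ` set w"
  shows "magnus wt w f (i # v) = f (i # v)"
proof -
  have "i \<notin> fst ` set w \<longrightarrow> magnus wt w f (i # v) = f (i # v)"
    using range_lshift[of wt, OF wt]
    by (induction rule: word_eval_unip_induct) (auto simp: lshift_def series_apply)
  then show ?thesis using assms by simp
qed

text \<open>If [w, x_i] has degree j + 1, the expansion m of w satisfies X_i m = m X_i up to weight
  j. No monomial of m begins with X_i, so comparing coefficients at v X_i gives 0 for every nonempty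
  v of weight below j. Magnus' criterion then applies inside F_i.\<close>

lemma lower_central_of_commutator_gen:
  assumes i: "i < n" and w: "w \<in> carrier (free_group i)"
    and comm: "commutator (free_group n) w (gen i) \<in> lower_central (free_group n) (Suc j)"
  shows "w \<in> lower_central (free_group i) j"
proof -
  \<comment> \<open>Letters outside F_n get weight \<open>Suc j\<close>, leaving finitely many of
    weight below \<open>j\<close>.\<close>
  define wt where "wt s = (if s < n then 1 else Suc j)" for s
  have wt: "1 \<le> wt s" for s by (simp add: wt_def)
  have wi: "wt i = 1" using i by (simp add: wt_def)
  let ?U = "unip_group wt"
  note r = range_lshift[of wt, OF wt]
  then have r': "range lshift \<subseteq> carrier ?U" by simp
  have hom: "magnus wt \<in> hom (free_group n) ?U" by (rule U.word_eval_hom[OF r'])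
  then have gh: "group_hom (free_group n) ?U (magnus wt)"
    by (intro group_hom.intro group_hom_axioms.intro group_free_group U.is_group)
  have wn: "w \<in> carrier (free_group n)" using w free_group_mono[of i n] i by auto
  have Li: "lshift i \<in> carrier ?U" using r' by auto
  have mw: "magnus wt w \<in> carrier ?U" using U.word_eval_closed[OF r'] .
  have mg: "magnus wt (gen i) = lshift i" using U.r_one[OF Li] by (simp add: gen_def)
  define c where "c = commutator ?U (magnus wt w) (lshift i)"
  have "magnus wt (commutator (free_group n) w (gen i)) \<in> unip wt (Suc j)"
    by (rule hom_lower_central[OF group_free_group U.central_filtration_axioms hom comm])
  then have c: "c \<in> unip wt (Suc j)"
    unfolding c_def group_hom_commutator[OF gh wn gen_closed[OF i]] mg .
  have swap: "c \<otimes>\<^bsub>?U\<^esub> (lshift i \<otimes>\<^bsub>?U\<^esub> magnus wt w) = magnus wt w \<otimes>\<^bsub>?U\<^esub> lshift i"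
    unfolding c_def commutator_def using Li mw
    by (simp only: U.word_simps U.l_inv U.r_one U.m_closed U.inv_closed)
  have Li1: "lshift i \<in> unip wt (Suc 0)" using Li by simp
  have mw1: "magnus wt w \<in> unip wt (Suc 0)" using mw by simp
  have x: "lshift i \<otimes>\<^bsub>?U\<^esub> magnus wt w \<in> unip wt (Suc 0)" using U.m_closed[OF Li mw] by simp
  have eq: "c (lshift i (magnus wt w f)) = magnus wt w (lshift i f)" for f
    using fun_cong[OF swap, of f]
    unfolding unip_mult[OF unip_1[OF c] x] unip_mult[OF Li1 mw1] unip_mult[OF mw1 Li1] .
  define m where "m = magnus wt w series_one"
  \<comment> \<open>At the series 1, left and right multiplication by 1 + X_i agree; this turns
    \<open>eq\<close> into c ((1 + X_i) m) = m (1 + X_i).\<close>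
  have "lshift i series_one = series_one + rmult i series_one"
  proof
    show "lshift i series_one v = (series_one + rmult i series_one) v" for v
      by (cases v) (auto simp: lshift_def series_apply rmult_def series_one_def)
  qed
  then have "c (lshift i m) = m + rmult i m"
    using eq[of series_one] by (simp only: m_def unip_add[OF mw1] magnus_rmult[of wt, OF wt])
  moreover have "c (lshift i m) - lshift i m \<in> series_filt wt (Suc (Suc j))"
    using unip_step'[OF c, of _ "Suc 0"] by (simp add: series_filt_1)
  ultimately have diff: "rmult i m - lmult i m \<in> series_filt wt (Suc (Suc j))"
    by (simp add: lshift_def)
  have head: "m (i # v) = 0" for v
  proof -
    have "i \<notin> fst ` set w" using w by (auto simp: free_group_simps)
    then show ?thesis unfolding m_def by (subst magnus_avoid[of wt, OF wt]) (auto simp: series_one_def)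
  qed
  have "m - series_one \<in> series_filt wt (Suc j)"
  proof -
    have "m v = series_one v" if v: "word_weight wt v < j" for v
    proof (cases v)
      case Nil
      then show ?thesis using magnus_Nil[of wt, OF wt] by (simp add: m_def)
    next
      case (Cons q u)
      have "(rmult i m - lmult i m) (v @ [i]) = 0"
        using diff v wi by (simp add: series_filt_def)
      moreover have "rmult i m (v @ [i]) = m v" by (simp add: rmult_def)
      ultimately show ?thesis
        using head Cons by (auto simp: series_apply series_one_def split: if_splits)
    qed
    then show ?thesis by (simp add: series_filt_def series_apply)
  qed
  moreover interpret L: central_filtration "free_group i" "lower_central (free_group i)"
    by (rule F.lower_central_filtration)
  have "fgen i s \<in> lower_central (free_group i) (wt s)" for s
    using gen_closed[of s i] L.N_one[of "wt s"] i
    by (auto simp: fgen_def wt_def free_group_simps(3))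
  moreover have "finite {s. wt s < j}"
    by (rule finite_subset[of _ "{..<n}"]) (auto simp: wt_def)
  ultimately have "word_eval (free_group i) (fgen i) w \<in> lower_central (free_group i) j"
    using L.magnus_criterion[of wt j "fgen i" w] wt by (simp add: m_def)
  then show ?thesis using word_eval_fgen[OF w] by simp
qed


section \<open>The Andreadakis filtration\<close>

text \<open>Reduces congruence of \<sigma> with the identity modulo \<open>N k\<close> to a check on
  generators.\<close>

lemma (in central_filtration) subgroup_displacement:
  assumes "\<sigma> \<in> hom G G" shows "subgroup {h \<in> carrier G. \<sigma> h \<otimes> inv h \<in> N k} G"
proof -
  interpret \<sigma>: group_hom G G \<sigma> using assms by unfold_locales
  show ?thesis
  proof (rule subgroupI)
    show "{h \<in> carrier G. \<sigma> h \<otimes> inv h \<in> N k} \<noteq> {}" using N_one by (auto intro!: exI[of _ \<one>])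
    show "inv h \<in> {h \<in> carrier G. \<sigma> h \<otimes> inv h \<in> N k}" if "h \<in> {h \<in> carrier G. \<sigma> h \<otimes> inv h \<in> N k}" for h
    proof -
      have h: "h \<in> carrier G" "\<sigma> h \<otimes> inv h \<in> N k" using that by auto
      have "inv h \<otimes> inv (\<sigma> h \<otimes> inv h) \<otimes> inv (inv h) \<in> N k"
        using h by (intro N_conj N_inv) auto
      then show ?thesis using h by (simp add: word_simps)
    qed
    show "g \<otimes> h \<in> {h \<in> carrier G. \<sigma> h \<otimes> inv h \<in> N k}"
      if "g \<in> {h \<in> carrier G. \<sigma> h \<otimes> inv h \<in> N k}" "h \<in> {h \<in> carrier G. \<sigma> h \<otimes> inv h \<in> N k}" for g h
    proof -
      have h: "h \<in> carrier G" "\<sigma> h \<otimes> inv h \<in> N k" "g \<in> carrier G" "\<sigma> g \<otimes> inv g \<in> N k"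
        using that by auto
      have "\<sigma> g \<otimes> inv g \<otimes> (g \<otimes> (\<sigma> h \<otimes> inv h) \<otimes> inv g) \<in> N k"
        using N_mult[OF h(4) N_conj[OF h(3,2)]] .
      then show ?thesis using h by (simp add: word_simps)
    qed
  qed auto
qed

text \<open>The Andreadakis condition looks at degree 1 only; this propagates the shift to every
  degree, by induction along the generators [g, a] of the next term.\<close>

lemma (in group) lower_central_displacement:
  assumes \<sigma>: "\<sigma> \<in> hom G G" and j: "1 \<le> j"
    and disp: "\<And>x. x \<in> carrier G \<Longrightarrow> \<sigma> x \<otimes> inv x \<in> lower_central G (Suc j)"
    and h: "h \<in> lower_central G l"
  shows "\<sigma> h \<otimes> inv h \<in> lower_central G (l + j)"
proof -
  interpret L: central_filtration G "lower_central G" by (rule lower_central_filtration)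
  interpret \<sigma>: group_hom G G \<sigma> using \<sigma> by unfold_locales
  have *: "\<forall>h\<in>lower_central G (Suc l). \<sigma> h \<otimes> inv h \<in> lower_central G (Suc l + j)" for l
  proof (induction l)
    case 0
    then show ?case using disp by simp
  next
    case (Suc l)
    let ?M = "lower_central G (Suc (Suc l) + j)"
    let ?D = "{h \<in> carrier G. \<sigma> h \<otimes> inv h \<in> ?M}"
    have "commutator G g a \<in> ?D" if g: "g \<in> carrier G" and a: "a \<in> lower_central G (Suc l)" for g a
    proof -
      have ac: "a \<in> carrier G" using a L.N_carrier by blast
      define p q where "p = \<sigma> g \<otimes> inv g" and "q = \<sigma> a \<otimes> inv a"
      have p: "p \<in> lower_central G (Suc j)" and q: "q \<in> lower_central G (Suc l + j)"
        using disp[OF g] Suc a by (auto simp: p_def q_def)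
      have c: "p \<in> carrier G" "q \<in> carrier G" using p q L.N_carrier by blast+
      have \<sigma>ga: "\<sigma> g = p \<otimes> g" "\<sigma> a = q \<otimes> a"
        using g ac by (simp_all add: p_def q_def word_simps)
      define y where "y = q \<otimes> a"
      have "q \<in> lower_central G (Suc l)" using q L.N_antimono[of "Suc l" "Suc l + j"] by auto
      then have y: "y \<in> lower_central G (Suc l)" using a L.N_mult by (simp add: y_def)
      have yc: "y \<in> carrier G" using y L.N_carrier by blast
      have py: "commutator G p y \<in> ?M"
        using L.N_commutator[OF _ _ p y] by (simp add: ac_simps del: lower_central.simps)
      have gq: "commutator G g q \<in> ?M"
        using L.N_commutator[of 1 "Suc l + j" g q] g q by simp
      have move: "commutator G u v \<in> ?M"
        if u: "u \<in> lower_central G (Suc j) \<or> u \<in> lower_central G (Suc l + j)"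
          and v: "v \<in> lower_central G (Suc (Suc l))" for u v
      proof -
        have "commutator G u v \<in> lower_central G (Suc j + Suc (Suc l))
            \<or> commutator G u v \<in> lower_central G (Suc l + j + Suc (Suc l))"
          using L.N_commutator[of "Suc j" "Suc (Suc l)" u v]
            L.N_commutator[of "Suc l + j" "Suc (Suc l)" u v] u v by auto
        moreover have "lower_central G (Suc j + Suc (Suc l)) \<subseteq> ?M"
          "lower_central G (Suc l + j + Suc (Suc l)) \<subseteq> ?M"
          by (intro L.N_antimono; simp)+
        ultimately show ?thesis by blast
      qed
      have gy: "commutator G g y \<in> lower_central G (Suc (Suc l))"
        and ga: "commutator G g a \<in> lower_central G (Suc (Suc l))"
        using commutator_lower_central g a y by blast+
      \<comment> \<open>With \<sigma> g = p g and \<sigma> a = y = q a: [p g, y] = [p, [g, y]]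
        [g, y] [p, y] and [g, q a] = [g, q] [q, [g, a]] [g, a]. Once [g, a] is removed, all factors
        have degree at least l + 2 + j, up to conjugation.\<close>
      have "commutator G p (commutator G g y)
          \<otimes> (commutator G g y \<otimes> commutator G p y \<otimes> inv (commutator G g y))
          \<otimes> (commutator G g q \<otimes> commutator G q (commutator G g a)) \<in> ?M"
        using move[OF disjI1[OF p] gy] move[OF disjI2[OF q] ga] py gq g yc
        by (intro L.N_mult L.N_conj) auto
      also have "commutator G p (commutator G g y)
          \<otimes> (commutator G g y \<otimes> commutator G p y \<otimes> inv (commutator G g y))
          \<otimes> (commutator G g q \<otimes> commutator G q (commutator G g a))
        = commutator G (p \<otimes> g) y \<otimes> inv (commutator G g a)"
        unfolding y_def using g ac c by (simp add: commutator_def word_simps)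
      also have "\<dots> = \<sigma> (commutator G g a) \<otimes> inv (commutator G g a)"
        unfolding y_def group_hom_commutator[OF \<sigma>.group_hom_axioms g ac] \<sigma>ga ..
      finally show ?thesis using g ac by simp
    qed
    then have "generate G {commutator G g a |g a. g \<in> carrier G \<and> a \<in> lower_central G (Suc l)} \<subseteq> ?D"
      by (intro generate_subgroup_incl L.subgroup_displacement[OF \<sigma>]) blast
    then show ?case unfolding lower_central_Suc_Suc by blast
  qed
  show ?thesis
  proof (cases l)
    case 0
    then show ?thesis using disp h L.N_Suc[of j] by auto
  next
    case (Suc l')
    then show ?thesis using * h by blast
  qed
qed

lemma andreadakis_eq_stabiliser:
  assumes "1 \<le> j"
  shows "andreadakis n j = stabiliser (free_group n) (lower_central (free_group n)) j"
proof
  show "stabiliser (free_group n) (lower_central (free_group n)) j \<subseteq> andreadakis n j"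
  proof
    fix \<sigma> assume s: "\<sigma> \<in> stabiliser (free_group n) (lower_central (free_group n)) j"
    then have "\<forall>h\<in>lower_central (free_group n) (Suc 0). \<sigma> h \<otimes>\<^bsub>free_group n\<^esub> inv\<^bsub>free_group n\<^esub> h
        \<in> lower_central (free_group n) (Suc 0 + max 1 j)"
      unfolding stabiliser_def by blast
    then show "\<sigma> \<in> andreadakis n j"
      using s assms by (simp add: andreadakis_def stabiliser_def max_def)
  qed
  show "andreadakis n j \<subseteq> stabiliser (free_group n) (lower_central (free_group n)) j"
  proof
    fix \<sigma> assume s: "\<sigma> \<in> andreadakis n j"
    then have a: "\<sigma> \<in> auto (free_group n)" by (simp add: andreadakis_def)
    have "\<sigma> h \<otimes>\<^bsub>free_group n\<^esub> inv\<^bsub>free_group n\<^esub> h \<in> lower_central (free_group n) (l + max 1 j)"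
      if "h \<in> lower_central (free_group n) l" for l h
      using F.lower_central_displacement[OF auto_hom[OF a] assms _ that] s assms
      by (simp add: andreadakis_def max_def)
    then show "\<sigma> \<in> stabiliser (free_group n) (lower_central (free_group n)) j"
      using a by (simp add: stabiliser_def)
  qed
qed

lemma IA_eq_andreadakis: "IA n = andreadakis n (Suc 0)"
  by (simp add: IA_def andreadakis_def numeral_2_eq_2)

interpretation FL: central_filtration "free_group n" "lower_central (free_group n)" for n
  by (rule F.lower_central_filtration)

lemma IA_filtration:
  "central_filtration ((AutF n)\<lparr>carrier := IA n\<rparr>)
    (stabiliser (free_group n) (lower_central (free_group n)))"
  using FL.stabiliser_filtration[of n] by (simp add: IA_eq_andreadakis andreadakis_eq_stabiliser)

interpretation A: group "AutF n" for n
  by (rule F.AutoGroup)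

lemma subgroup_andreadakis: "1 \<le> j \<Longrightarrow> subgroup (andreadakis n j) (AutF n)"
  using FL.subgroup_stabiliser by (simp add: andreadakis_eq_stabiliser)

lemma subgroup_IA: "subgroup (IA n) (AutF n)"
  by (simp add: IA_eq_andreadakis subgroup_andreadakis)

text \<open>The easy inclusion: the Andreadakis filtration is strongly central on IA_n, and the
  lower central series descends fastest.\<close>

lemma lower_central_IA_le:
  assumes "1 \<le> j" shows "lower_central ((AutF n)\<lparr>carrier := IA n\<rparr>) j \<subseteq> andreadakis n j"
proof
  fix \<sigma> assume "\<sigma> \<in> lower_central ((AutF n)\<lparr>carrier := IA n\<rparr>) j"
  moreover have "id \<in> hom ((AutF n)\<lparr>carrier := IA n\<rparr>) ((AutF n)\<lparr>carrier := IA n\<rparr>)"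
    by (simp add: hom_def)
  ultimately show "\<sigma> \<in> andreadakis n j"
    unfolding andreadakis_eq_stabiliser[OF assms]
    using hom_lower_central[OF A.subgroup_imp_group[OF subgroup_IA] IA_filtration, of id n n \<sigma> j]
    by simp
qed

lemma andreadakisI:
  assumes "\<sigma> \<in> auto (free_group n)"
    and "\<And>i. i < n \<Longrightarrow> \<sigma> (gen i) \<otimes>\<^bsub>free_group n\<^esub> inv\<^bsub>free_group n\<^esub> gen i \<in> lower_central (free_group n) (Suc j)"
  shows "\<sigma> \<in> andreadakis n j"
proof -
  let ?D = "{h \<in> carrier (free_group n). \<sigma> h \<otimes>\<^bsub>free_group n\<^esub> inv\<^bsub>free_group n\<^esub> h \<in> lower_central (free_group n) (Suc j)}"
  have D: "subgroup ?D (free_group n)"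
    by (rule FL.subgroup_displacement[OF auto_hom[OF assms(1)]])
  have "x \<in> ?D" if x: "x \<in> carrier (free_group n)" for x
  proof -
    have "fgen n (fst a) \<in> ?D" if "a \<in> set x" for a
    proof -
      have "fst a < n" using x that by (simp add: free_group_simps)
      then show ?thesis using assms(2) gen_closed by (simp add: fgen_def)
    qed
    from F.word_eval_subgroup[where f = "fgen n" and w = x, OF D this] show ?thesis by (simp add: word_eval_fgen[OF x])
  qed
  then show ?thesis using assms(1) by (simp add: andreadakis_def)
qed

section \<open>Triangular automorphisms\<close>

lemma free_group_sub: "k \<le> n \<Longrightarrow> w \<in> carrier (free_group k) \<Longrightarrow> w \<in> carrier (free_group n)"
  using free_group_mono by blast

lemma mult_free_group_eq: "u \<otimes>\<^bsub>free_group k\<^esub> v = u \<otimes>\<^bsub>free_group n\<^esub> v"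
  by (simp add: free_group_simps)

lemma lower_central_free_group_mono:
  assumes "k \<le> n" "w \<in> lower_central (free_group k) j" shows "w \<in> lower_central (free_group n) j"
proof -
  have "id \<in> hom (free_group k) (free_group n)"
    using free_group_sub[OF assms(1)] mult_free_group_eq[of k _ _ n] by (auto simp: hom_def)
  from hom_lower_central[OF group_free_group F.lower_central_filtration this assms(2)]
  show ?thesis by simp
qed

definition triangular_image :: "nat \<Rightarrow> nat \<Rightarrow> letter list \<Rightarrow> bool" where
  "triangular_image n k y \<longleftrightarrow> (\<exists>w \<in> carrier (free_group k). \<exists>\<gamma> \<in> lower_central (free_group k) 2.
     y = inv\<^bsub>free_group n\<^esub> w \<otimes>\<^bsub>free_group n\<^esub> gen k \<otimes>\<^bsub>free_group n\<^esub> w \<otimes>\<^bsub>free_group n\<^esub> \<gamma>)"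

lemma IA_plus_iff:
  "\<phi> \<in> IA_plus n \<longleftrightarrow> \<phi> \<in> auto (free_group n) \<and> (\<forall>k<n. triangular_image n k (\<phi> (gen k)))"
  unfolding IA_plus_def triangular_image_def
  by (auto simp: initial_subgroup_eq free_group_restrict)

lemma IA_plus_auto: "\<phi> \<in> IA_plus n \<Longrightarrow> \<phi> \<in> auto (free_group n)"
  by (simp add: IA_plus_iff)

lemma triangular_image_closed:
  assumes "k < n" "triangular_image n k y" shows "y \<in> carrier (free_group (Suc k))"
proof -
  obtain w \<gamma> where w: "w \<in> carrier (free_group k)" and g: "\<gamma> \<in> lower_central (free_group k) 2"
    and y: "y = inv\<^bsub>free_group n\<^esub> w \<otimes>\<^bsub>free_group n\<^esub> gen k \<otimes>\<^bsub>free_group n\<^esub> w \<otimes>\<^bsub>free_group n\<^esub> \<gamma>"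
    using assms(2) unfolding triangular_image_def by blast
  have "w \<in> carrier (free_group (Suc k))" "\<gamma> \<in> carrier (free_group (Suc k))"
    using w FL.N_carrier[OF g] by (auto intro: free_group_sub[of k])
  then show ?thesis
    unfolding y using subgroup_free_group[of "Suc k" n] assms(1) gen_closed[of k "Suc k"]
    by (auto intro!: subgroup.m_closed subgroup.m_inv_closed)
qed

lemma auto_preserves_free_group:
  assumes \<phi>: "\<phi> \<in> auto (free_group n)" and k: "k \<le> n"
    and img: "\<And>i. i < k \<Longrightarrow> \<phi> (gen i) \<in> carrier (free_group k)"
    and w: "w \<in> carrier (free_group k)"
  shows "\<phi> w \<in> carrier (free_group k)"
proof -
  have "\<phi> (fgen n (fst a)) \<in> carrier (free_group k)" if "a \<in> set w" for a
  proof -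
    have "fst a < k" using that w by (simp add: free_group_simps)
    then show ?thesis using img k by (simp add: fgen_def)
  qed
  from F.word_eval_subgroup[where f = "\<lambda>s. \<phi> (fgen n s)" and w = w, OF subgroup_free_group[OF k] this]
  show ?thesis
    using free_group_hom_eq[OF group_free_group auto_hom[OF \<phi>] free_group_sub[OF k w]] by simp
qed

lemma auto_preserves_lower_central:
  assumes \<phi>: "\<phi> \<in> auto (free_group n)" and k: "k \<le> n"
    and pres: "\<And>w. w \<in> carrier (free_group k) \<Longrightarrow> \<phi> w \<in> carrier (free_group k)"
    and w: "w \<in> lower_central (free_group k) j"
  shows "\<phi> w \<in> lower_central (free_group k) j"
proof (rule hom_lower_central[OF group_free_group F.lower_central_filtration _ w])
  show "\<phi> \<in> hom (free_group k) (free_group k)"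
    using pres auto_mult[OF \<phi> free_group_sub[OF k] free_group_sub[OF k]]
    by (auto simp: hom_def mult_free_group_eq[of k _ _ n])
qed

lemma IA_plus_preserves:
  assumes "\<phi> \<in> IA_plus n" "k \<le> n" "w \<in> carrier (free_group k)"
  shows "\<phi> w \<in> carrier (free_group k)"
proof (rule auto_preserves_free_group[OF IA_plus_auto[OF assms(1)] assms(2) _ assms(3)])
  fix i assume i: "i < k"
  then have "triangular_image n i (\<phi> (gen i))" using assms by (simp add: IA_plus_iff)
  from triangular_image_closed[OF _ this] show "\<phi> (gen i) \<in> carrier (free_group k)"
    using i assms(2) free_group_sub[of "Suc i" k] by simp
qed

lemma IA_plus_mult:
  assumes \<phi>: "\<phi> \<in> IA_plus n" and \<psi>: "\<psi> \<in> IA_plus n"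
  shows "\<phi> \<otimes>\<^bsub>AutF n\<^esub> \<psi> \<in> IA_plus n"
proof -
  let ?F = "free_group n"
  note a = IA_plus_auto[OF \<phi>] IA_plus_auto[OF \<psi>]
  have "triangular_image n k (\<phi> (\<psi> (gen k)))" if k: "k < n" for k
  proof -
    obtain w \<gamma> where w: "w \<in> carrier (free_group k)" and g: "\<gamma> \<in> lower_central (free_group k) 2"
      and 1: "\<phi> (gen k) = inv\<^bsub>?F\<^esub> w \<otimes>\<^bsub>?F\<^esub> gen k \<otimes>\<^bsub>?F\<^esub> w \<otimes>\<^bsub>?F\<^esub> \<gamma>"
      using \<phi> k unfolding IA_plus_iff triangular_image_def by blast
    obtain w' \<gamma>' where w': "w' \<in> carrier (free_group k)" and g': "\<gamma>' \<in> lower_central (free_group k) 2"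
      and 2: "\<psi> (gen k) = inv\<^bsub>?F\<^esub> w' \<otimes>\<^bsub>?F\<^esub> gen k \<otimes>\<^bsub>?F\<^esub> w' \<otimes>\<^bsub>?F\<^esub> \<gamma>'"
      using \<psi> k unfolding IA_plus_iff triangular_image_def by blast
    have kn: "k \<le> n" using k by simp
    define u where "u = \<phi> w'"
    have u: "u \<in> carrier (free_group k)" unfolding u_def by (rule IA_plus_preserves[OF \<phi> kn w'])
    have pg: "\<phi> \<gamma>' \<in> lower_central (free_group k) 2"
      by (rule auto_preserves_lower_central[OF a(1) kn IA_plus_preserves[OF \<phi> kn] g'])
    note sub = free_group_sub[OF kn]
    note c = sub[OF w] sub[OF w'] sub[OF u] sub[OF FL.N_carrier[OF g]] sub[OF FL.N_carrier[OF g']]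
      sub[OF FL.N_carrier[OF pg]] gen_closed[OF k]
    \<comment> \<open>Substitution gives u^-1 w^-1 x_k w \<gamma> u (\<phi> \<gamma>'); moving u to
      the left of \<gamma> replaces \<gamma> by u^-1 \<gamma> u.\<close>
    define \<delta> where "\<delta> = inv\<^bsub>free_group k\<^esub> u \<otimes>\<^bsub>free_group k\<^esub> \<gamma> \<otimes>\<^bsub>free_group k\<^esub> inv\<^bsub>free_group k\<^esub> (inv\<^bsub>free_group k\<^esub> u) \<otimes>\<^bsub>free_group k\<^esub> \<phi> \<gamma>'"
    have \<delta>: "\<delta> \<in> lower_central (free_group k) 2"
      unfolding \<delta>_def using g pg u by (intro FL.N_mult FL.N_conj) auto
    have \<delta>n: "\<delta> = inv\<^bsub>?F\<^esub> u \<otimes>\<^bsub>?F\<^esub> \<gamma> \<otimes>\<^bsub>?F\<^esub> u \<otimes>\<^bsub>?F\<^esub> \<phi> \<gamma>'"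
      unfolding \<delta>_def using u by (simp add: mult_free_group_eq[of k _ _ n] inv_free_group_mono[OF kn])
    have "\<phi> (\<psi> (gen k)) = inv\<^bsub>?F\<^esub> u \<otimes>\<^bsub>?F\<^esub> \<phi> (gen k) \<otimes>\<^bsub>?F\<^esub> u \<otimes>\<^bsub>?F\<^esub> \<phi> \<gamma>'"
      unfolding 2 u_def using c by (simp add: auto_mult[OF a(1)] F.auto_inv[OF a(1)])
    also have "\<dots> = inv\<^bsub>?F\<^esub> (w \<otimes>\<^bsub>?F\<^esub> u) \<otimes>\<^bsub>?F\<^esub> gen k \<otimes>\<^bsub>?F\<^esub> (w \<otimes>\<^bsub>?F\<^esub> u) \<otimes>\<^bsub>?F\<^esub> \<delta>"
      unfolding 1 \<delta>n using c by (simp add: F.word_simps)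
    finally show ?thesis
      unfolding triangular_image_def using \<delta> F.m_closed[OF w u] by (auto simp: mult_free_group_eq[of k _ _ n])
  qed
  moreover have "\<phi> \<otimes>\<^bsub>AutF n\<^esub> \<psi> \<in> auto ?F" using A.m_closed[of \<phi> n \<psi>] a by simp
  ultimately show ?thesis
    using a gen_closed[of _ n] by (auto simp: IA_plus_iff F.AutoGroup_mult compose_def)
qed

text \<open>Induction on the generator: the images of the smaller generators show that the inverse
  \<psi> preserves F_k, and then the equation for \<phi> x_k can be solved for \<psi> x_k.\<close>

lemma IA_plus_inv:
  assumes \<phi>: "\<phi> \<in> IA_plus n"
  shows "inv\<^bsub>AutF n\<^esub> \<phi> \<in> IA_plus n"
proof -
  let ?F = "free_group n"
  define \<psi> where "\<psi> = inv\<^bsub>AutF n\<^esub> \<phi>"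
  have a: "\<phi> \<in> auto ?F" "\<psi> \<in> auto ?F"
    using IA_plus_auto[OF \<phi>] A.inv_closed[of \<phi> n] by (simp_all add: \<psi>_def)
  have inv: "\<psi> (\<phi> x) = x" if "x \<in> carrier ?F" for x
    unfolding \<psi>_def using F.auto_inverse_apply(2)[OF a(1) that] .
  have "triangular_image n k (\<psi> (gen k))" if k: "k < n" for k
    using k
  proof (induction k rule: less_induct)
    case (less k)
    have kn: "k \<le> n" using less.prems by simp
    obtain w \<gamma> where w: "w \<in> carrier (free_group k)" and g: "\<gamma> \<in> lower_central (free_group k) 2"
      and 1: "\<phi> (gen k) = inv\<^bsub>?F\<^esub> w \<otimes>\<^bsub>?F\<^esub> gen k \<otimes>\<^bsub>?F\<^esub> w \<otimes>\<^bsub>?F\<^esub> \<gamma>"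
      using \<phi> less.prems unfolding IA_plus_iff triangular_image_def by blast
    have pres: "\<psi> x \<in> carrier (free_group k)" if x: "x \<in> carrier (free_group k)" for x
    proof (rule auto_preserves_free_group[OF a(2) kn _ x])
      fix i assume i: "i < k"
      then have "triangular_image n i (\<psi> (gen i))" using less by simp
      from triangular_image_closed[OF _ this] show "\<psi> (gen i) \<in> carrier (free_group k)"
        using i kn free_group_sub[of "Suc i" k] by simp
    qed
    define v \<delta> where "v = inv\<^bsub>free_group k\<^esub> (\<psi> w)"
      and "\<delta> = \<psi> w \<otimes>\<^bsub>free_group k\<^esub> inv\<^bsub>free_group k\<^esub> (\<psi> \<gamma>) \<otimes>\<^bsub>free_group k\<^esub> inv\<^bsub>free_group k\<^esub> (\<psi> w)"
    have pw: "\<psi> w \<in> carrier (free_group k)" using pres[OF w] .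
    then have v: "v \<in> carrier (free_group k)" by (simp add: v_def)
    have pg: "\<psi> \<gamma> \<in> lower_central (free_group k) 2"
      by (rule auto_preserves_lower_central[OF a(2) kn pres g])
    then have \<delta>: "\<delta> \<in> lower_central (free_group k) 2"
      unfolding \<delta>_def using pw by (intro FL.N_conj FL.N_inv) auto
    note sub = free_group_sub[OF kn]
    note c = sub[OF w] sub[OF pw] sub[OF FL.N_carrier[OF g]] sub[OF FL.N_carrier[OF pg]] gen_closed[OF less.prems]
    have pk: "\<psi> (gen k) \<in> carrier ?F" using auto_closed[OF a(2)] c by simp
    have "gen k = inv\<^bsub>?F\<^esub> (\<psi> w) \<otimes>\<^bsub>?F\<^esub> \<psi> (gen k) \<otimes>\<^bsub>?F\<^esub> \<psi> w \<otimes>\<^bsub>?F\<^esub> \<psi> \<gamma>"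
      using inv[OF c(5)] c by (simp add: 1 auto_mult[OF a(2)] F.auto_inv[OF a(2)])
    then have "inv\<^bsub>?F\<^esub> v \<otimes>\<^bsub>?F\<^esub> gen k \<otimes>\<^bsub>?F\<^esub> v \<otimes>\<^bsub>?F\<^esub> \<delta> =
      inv\<^bsub>?F\<^esub> v \<otimes>\<^bsub>?F\<^esub> (inv\<^bsub>?F\<^esub> (\<psi> w) \<otimes>\<^bsub>?F\<^esub> \<psi> (gen k) \<otimes>\<^bsub>?F\<^esub> \<psi> w \<otimes>\<^bsub>?F\<^esub> \<psi> \<gamma>) \<otimes>\<^bsub>?F\<^esub> v \<otimes>\<^bsub>?F\<^esub> \<delta>"
      by simp
    also have "\<dots> = \<psi> (gen k)"
      unfolding v_def \<delta>_def using c pk FL.N_carrier[OF pg] pw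
      by (simp add: mult_free_group_eq[of k _ _ n] inv_free_group_mono[OF kn, symmetric]) (simp add: F.word_simps)
    finally show ?case unfolding triangular_image_def using v \<delta> by metis
  qed
  then show ?thesis using a by (simp add: IA_plus_iff \<psi>_def)
qed

lemma IA_plus_subset_IA: "IA_plus n \<subseteq> IA n"
proof
  fix \<phi> assume \<phi>: "\<phi> \<in> IA_plus n"
  let ?F = "free_group n"
  have "\<phi> (gen k) \<otimes>\<^bsub>?F\<^esub> inv\<^bsub>?F\<^esub> gen k \<in> lower_central ?F (Suc (Suc 0))" if k: "k < n" for k
  proof -
    obtain w \<gamma> where w: "w \<in> carrier (free_group k)" and g: "\<gamma> \<in> lower_central (free_group k) 2"
      and 1: "\<phi> (gen k) = inv\<^bsub>?F\<^esub> w \<otimes>\<^bsub>?F\<^esub> gen k \<otimes>\<^bsub>?F\<^esub> w \<otimes>\<^bsub>?F\<^esub> \<gamma>"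
      using \<phi> k unfolding IA_plus_iff triangular_image_def by blast
    have gn: "\<gamma> \<in> lower_central ?F (Suc (Suc 0))"
      using lower_central_free_group_mono[OF _ g, of n] k by (simp add: numeral_2_eq_2)
    have c: "w \<in> carrier ?F" "\<gamma> \<in> carrier ?F" "gen k \<in> carrier ?F"
      using free_group_sub[OF _ w] k FL.N_carrier[OF gn] gen_closed[OF k] by auto
    have "commutator ?F (inv\<^bsub>?F\<^esub> w) (gen k) \<otimes>\<^bsub>?F\<^esub> (gen k \<otimes>\<^bsub>?F\<^esub> \<gamma> \<otimes>\<^bsub>?F\<^esub> inv\<^bsub>?F\<^esub> gen k) \<in> lower_central ?F (Suc (Suc 0))"
      using c gn F.commutator_lower_central[of "inv\<^bsub>?F\<^esub> w" n "gen k" 0]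
      by (intro FL.N_mult FL.N_conj) auto
    also have "commutator ?F (inv\<^bsub>?F\<^esub> w) (gen k) \<otimes>\<^bsub>?F\<^esub> (gen k \<otimes>\<^bsub>?F\<^esub> \<gamma> \<otimes>\<^bsub>?F\<^esub> inv\<^bsub>?F\<^esub> gen k) =
      \<phi> (gen k) \<otimes>\<^bsub>?F\<^esub> inv\<^bsub>?F\<^esub> gen k"
      unfolding 1 using c by (simp add: commutator_def F.word_simps)
    finally show ?thesis .
  qed
  then show "\<phi> \<in> IA n"
    unfolding IA_eq_andreadakis using IA_plus_auto[OF \<phi>] by (intro andreadakisI) auto
qed

lemma one_triangular: "k < n \<Longrightarrow> triangular_image n k (gen k)"
  unfolding triangular_image_def
  by (rule bexI[of _ "[]"], rule bexI[of _ "[]"])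
     (use FL.N_one[of k 2] in \<open>auto simp: free_group_simps gen_def reduce_def inverse_letters_def
        F.inv_one[unfolded free_group_simps]\<close>)

lemma subgroup_IA_plus: "subgroup (IA_plus n) (AutF n)"
proof (rule A.subgroupI)
  have "\<one>\<^bsub>AutF n\<^esub> \<in> IA_plus n"
    using A.one_closed[of n] one_triangular gen_closed[of _ n]
    by (auto simp: IA_plus_iff F.AutoGroup_one)
  then show "IA_plus n \<noteq> {}" by blast
qed (use IA_plus_auto IA_plus_mult IA_plus_inv in auto)


subsection \<open>Automorphisms moving a single generator\<close>

text \<open>The two-sided form x_i \<mapsto> a x_i b contains the conjugations (a = w^-1, b = w) and
  the translations (a = 1), and for a, b in F_i it is closed under composition and
  inversion.\<close>

definition gen_map :: "nat \<Rightarrow> nat \<Rightarrow> letter list \<Rightarrow> letter list \<Rightarrow> letter list \<Rightarrow> letter list" where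
  "gen_map n i a b = (\<lambda>w\<in>carrier (free_group n). word_eval (free_group n)
     ((fgen n)(i := a \<otimes>\<^bsub>free_group n\<^esub> gen i \<otimes>\<^bsub>free_group n\<^esub> b)) w)"

context
  fixes n i :: nat
  assumes i: "i < n"
begin

lemma free_group_embed: "a \<in> carrier (free_group i) \<Longrightarrow> a \<in> carrier (free_group n)"
  using free_group_sub[of i n] i by simp

lemma gen_map_range:
  "\<lbrakk>a \<in> carrier (free_group i); b \<in> carrier (free_group i)\<rbrakk> \<Longrightarrow> range ((fgen n)(i := a \<otimes>\<^bsub>free_group n\<^esub> gen i \<otimes>\<^bsub>free_group n\<^esub> b)) \<subseteq> carrier (free_group n)"
  using range_fgen[of n n] free_group_embed gen_closed[OF i] by auto

lemma gen_map_hom: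
  assumes "a \<in> carrier (free_group i)" "b \<in> carrier (free_group i)" shows "gen_map n i a b \<in> hom (free_group n) (free_group n)"
  using F.word_eval_hom[OF gen_map_range[OF assms], of n] F.m_closed[of _ n]
  by (simp add: gen_map_def hom_def Pi_iff)

lemma gen_map_closed:
  "\<lbrakk>a \<in> carrier (free_group i); b \<in> carrier (free_group i); w \<in> carrier (free_group n)\<rbrakk> \<Longrightarrow> gen_map n i a b w \<in> carrier (free_group n)"
  using gen_map_hom by (auto simp: hom_def)

lemma gen_map_gen:
  assumes "a \<in> carrier (free_group i)" "b \<in> carrier (free_group i)" "k < n"
  shows "gen_map n i a b (gen k) = (if k = i then a \<otimes>\<^bsub>free_group n\<^esub> gen i \<otimes>\<^bsub>free_group n\<^esub> b else gen k)"
proof -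
  let ?f = "(fgen n)(i := a \<otimes>\<^bsub>free_group n\<^esub> gen i \<otimes>\<^bsub>free_group n\<^esub> b)"
  have "?f k \<in> carrier (free_group n)" using gen_map_range[OF assms(1,2)] by blast
  then have "word_eval (free_group n) ?f (gen k) = ?f k" by (simp add: gen_def)
  then show ?thesis using gen_closed assms(3) by (simp add: gen_map_def fgen_def)
qed

lemma gen_map_fixes:
  assumes "w \<in> carrier (free_group i)" shows "gen_map n i a b w = w"
proof -
  have "word_eval (free_group n) ((fgen n)(i := a \<otimes>\<^bsub>free_group n\<^esub> gen i \<otimes>\<^bsub>free_group n\<^esub> b)) w
    = word_eval (free_group n) (fgen n) w"
    by (rule word_eval_cong) (use assms in \<open>auto simp: free_group_simps\<close>)
  then show ?thesis using free_group_embed[OF assms] by (simp add: gen_map_def word_eval_fgen)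
qed

text \<open>The map applied last fixes a' and b', which lie in F_i; so left factors multiply in
  reverse order and right factors in order.\<close>

lemma gen_map_compose:
  assumes "a \<in> carrier (free_group i)" "b \<in> carrier (free_group i)" "a' \<in> carrier (free_group i)" "b' \<in> carrier (free_group i)"
  shows "compose (carrier (free_group n)) (gen_map n i a b) (gen_map n i a' b') =
    gen_map n i (a' \<otimes>\<^bsub>free_group n\<^esub> a) (b \<otimes>\<^bsub>free_group n\<^esub> b')" (is "?l = ?r")
proof (rule extensionalityI)
  show "?l \<in> extensional (carrier (free_group n))" "?r \<in> extensional (carrier (free_group n))"
    by (auto simp: gen_map_def)
  have c: "a' \<otimes>\<^bsub>free_group n\<^esub> a \<in> carrier (free_group i)" "b \<otimes>\<^bsub>free_group n\<^esub> b' \<in> carrier (free_group i)"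
    using F.m_closed[OF assms(3,1)] F.m_closed[OF assms(2,4)] by (simp_all add: mult_free_group_eq[of i _ _ n])
  note h = gen_map_hom[OF assms(1,2)] gen_map_hom[OF assms(3,4)]
  show "?l w = ?r w" if w: "w \<in> carrier (free_group n)" for w
  proof (rule free_group_hom_eqI[OF group_free_group _ gen_map_hom[OF c] _ w])
    show "?l \<in> hom (free_group n) (free_group n)" by (rule F.hom_compose[OF h(2,1)])
    fix k assume k: "k < n"
    have m: "gen_map n i a b (a' \<otimes>\<^bsub>free_group n\<^esub> gen i \<otimes>\<^bsub>free_group n\<^esub> b') =
      a' \<otimes>\<^bsub>free_group n\<^esub> (a \<otimes>\<^bsub>free_group n\<^esub> gen i \<otimes>\<^bsub>free_group n\<^esub> b) \<otimes>\<^bsub>free_group n\<^esub> b'"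
      using h(1) free_group_embed[OF assms(3)] free_group_embed[OF assms(4)] gen_closed[OF i]
        gen_map_gen[OF assms(1,2) i] gen_map_fixes[OF assms(3)] gen_map_fixes[OF assms(4)]
      by (simp add: hom_mult)
    show "?l (gen k) = ?r (gen k)"
      using k gen_closed[OF k] gen_closed[OF i] m assms[THEN free_group_embed]
      by (auto simp: compose_def gen_map_gen c assms F.m_assoc)
  qed
qed

lemma one_mem_free_group: "\<one>\<^bsub>free_group n\<^esub> \<in> carrier (free_group i)"
  by (simp add: free_group_simps)

lemma inv_mem_free_group: "a \<in> carrier (free_group i) \<Longrightarrow> inv\<^bsub>free_group n\<^esub> a \<in> carrier (free_group i)"
  using F.inv_closed[of a i] i by (simp add: inv_free_group_mono[of i n])

lemma gen_map_one: "gen_map n i \<one>\<^bsub>free_group n\<^esub> \<one>\<^bsub>free_group n\<^esub> = (\<lambda>w\<in>carrier (free_group n). w)"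
proof (rule extensionalityI)
  show "gen_map n i \<one>\<^bsub>free_group n\<^esub> \<one>\<^bsub>free_group n\<^esub> w = (\<lambda>w\<in>carrier (free_group n). w) w"
    if w: "w \<in> carrier (free_group n)" for w
  proof (rule free_group_hom_eqI[OF group_free_group gen_map_hom[OF one_mem_free_group one_mem_free_group] _ _ w])
    show "(\<lambda>w\<in>carrier (free_group n). w) \<in> hom (free_group n) (free_group n)"
      using auto_hom[OF F.id_in_auto] .
  qed (use gen_closed in \<open>auto simp: gen_map_gen one_mem_free_group\<close>)
qed (auto simp: gen_map_def)

lemma gen_map_auto:
  assumes a: "a \<in> carrier (free_group i)" and b: "b \<in> carrier (free_group i)" shows "gen_map n i a b \<in> auto (free_group n)"
proof -
  let ?a = "inv\<^bsub>free_group n\<^esub> a" and ?b = "inv\<^bsub>free_group n\<^esub> b" and ?C = "carrier (free_group n)"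
  have "compose ?C (gen_map n i a b) (gen_map n i ?a ?b) = (\<lambda>w\<in>?C. w)"
    "compose ?C (gen_map n i ?a ?b) (gen_map n i a b) = (\<lambda>w\<in>?C. w)"
    using a b inv_mem_free_group free_group_embed by (simp_all add: gen_map_compose gen_map_one)
  then have eq: "gen_map n i a b (gen_map n i ?a ?b w) = w" "gen_map n i ?a ?b (gen_map n i a b w) = w"
    if "w \<in> ?C" for w
    using that by (auto simp: compose_def fun_eq_iff split: if_splits)
  have "bij_betw (gen_map n i a b) ?C ?C"
    by (rule bij_betwI[where g = "gen_map n i ?a ?b"])
       (use eq gen_map_closed a b inv_mem_free_group in auto)
  then show ?thesis
    using gen_map_hom[OF a b] by (auto simp: auto_def Bij_def gen_map_def)
qed

lemma gen_map_mult:
  "\<lbrakk>a \<in> carrier (free_group i); b \<in> carrier (free_group i); a' \<in> carrier (free_group i); b' \<in> carrier (free_group i)\<rbrakk> \<Longrightarrow> gen_map n i a b \<otimes>\<^bsub>AutF n\<^esub> gen_map n i a' b' =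
    gen_map n i (a' \<otimes>\<^bsub>free_group n\<^esub> a) (b \<otimes>\<^bsub>free_group n\<^esub> b')"
  by (simp add: F.AutoGroup_mult gen_map_auto gen_map_compose)

lemma gen_map_inv:
  assumes "a \<in> carrier (free_group i)" "b \<in> carrier (free_group i)"
  shows "inv\<^bsub>AutF n\<^esub> (gen_map n i a b) = gen_map n i (inv\<^bsub>free_group n\<^esub> a) (inv\<^bsub>free_group n\<^esub> b)"
  by (rule A.inv_equality)
     (use assms inv_mem_free_group free_group_embed in \<open>auto simp: gen_map_mult gen_map_auto gen_map_one F.AutoGroup_one\<close>)

lemma gen_map_IA_plus:
  assumes a: "a \<in> carrier (free_group i)" and b: "b \<in> carrier (free_group i)" and ab: "a \<otimes>\<^bsub>free_group n\<^esub> b \<in> lower_central (free_group i) 2"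
  shows "gen_map n i a b \<in> IA_plus n"
proof -
  have "triangular_image n k (gen_map n i a b (gen k))" if k: "k < n" for k
  proof (cases "k = i")
    case True
    \<comment> \<open>The triangular form: the conjugate of x_i by a^-1, followed by a b.\<close>
    have "a \<otimes>\<^bsub>free_group n\<^esub> gen i \<otimes>\<^bsub>free_group n\<^esub> b =
      inv\<^bsub>free_group n\<^esub> (inv\<^bsub>free_group n\<^esub> a) \<otimes>\<^bsub>free_group n\<^esub> gen i \<otimes>\<^bsub>free_group n\<^esub> inv\<^bsub>free_group n\<^esub> a
        \<otimes>\<^bsub>free_group n\<^esub> (a \<otimes>\<^bsub>free_group n\<^esub> b)"
      using free_group_embed[OF a] free_group_embed[OF b] gen_closed[OF i] by (simp add: F.word_simps)
    then show ?thesis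
      unfolding triangular_image_def using True gen_map_gen[OF a b i] ab inv_mem_free_group[OF a] by metis
  next
    case False
    then show ?thesis using one_triangular k gen_map_gen[OF a b k] by simp
  qed
  then show ?thesis using gen_map_auto[OF a b] by (simp add: IA_plus_iff)
qed

text \<open>Left and right factors are independent: on the left the commutator with 1 is trivial, on
  the right it is [w, \<gamma>].\<close>

lemma commutator_gen_map:
  assumes w: "w \<in> carrier (free_group i)" and g: "\<gamma> \<in> carrier (free_group i)"
  shows "commutator (AutF n) (gen_map n i (inv\<^bsub>free_group n\<^esub> w) w) (gen_map n i \<one>\<^bsub>free_group n\<^esub> \<gamma>)
    = gen_map n i \<one>\<^bsub>free_group n\<^esub> (commutator (free_group i) w \<gamma>)"
proof -
  have m: "x \<otimes>\<^bsub>free_group n\<^esub> y \<in> carrier (free_group i)" if "x \<in> carrier (free_group i)" "y \<in> carrier (free_group i)" for x y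
    using F.m_closed[OF that] by (simp add: mult_free_group_eq[of i _ _ n])
  show ?thesis
    unfolding commutator_def
    using w g inv_mem_free_group one_mem_free_group m free_group_embed i
    by (simp add: gen_map_inv gen_map_mult mult_free_group_eq[of i _ _ n] inv_free_group_mono[of i n, symmetric])
qed

end

section \<open>The lower central series of the triangular group\<close>

abbreviation IA_plus_group :: "nat \<Rightarrow> (letter list \<Rightarrow> letter list) monoid" where
  "IA_plus_group n \<equiv> (AutF n)\<lparr>carrier := IA_plus n\<rparr>"

interpretation P: group "IA_plus_group n" for n
  by (rule A.subgroup_imp_group[OF subgroup_IA_plus])

interpretation PL: central_filtration "IA_plus_group n" "lower_central (IA_plus_group n)" for n
  by (rule P.lower_central_filtration)

text \<open>Conjugation of x_i by w is a homomorphism in w from F_i to the triangular group, so it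
  respects lower central series.\<close>

lemma gen_map_conj_lower_central:
  assumes i: "i < n" and w: "w \<in> lower_central (free_group i) j"
  shows "gen_map n i (inv\<^bsub>free_group n\<^esub> w) w \<in> lower_central (IA_plus_group n) j"
proof (rule hom_lower_central[OF group_free_group P.lower_central_filtration _ w])
  let ?c = "\<lambda>w. gen_map n i (inv\<^bsub>free_group n\<^esub> w) w"
  have "?c w \<in> IA_plus n" if w: "w \<in> carrier (free_group i)" for w
    using w inv_mem_free_group[OF i w] free_group_embed[OF i w] FL.N_one[of i 2]
    by (intro gen_map_IA_plus[OF i]) (auto simp: free_group_simps(3))
  moreover have "?c (u \<otimes>\<^bsub>free_group i\<^esub> v) = ?c u \<otimes>\<^bsub>AutF n\<^esub> ?c v"
    if "u \<in> carrier (free_group i)" "v \<in> carrier (free_group i)" for u v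
    using that inv_mem_free_group[OF i] free_group_embed[OF i] F.inv_mult_group[of u n v]
    by (simp add: gen_map_mult[OF i] mult_free_group_eq[of i _ _ n])
  ultimately show "?c \<in> hom (free_group i) (IA_plus_group n)" by (auto simp: hom_def)
qed

text \<open>The degree drops by one: a translation by \<gamma> of degree 2 is merely triangular,
  which starts the induction. Then the translation by [w, \<delta>] is the commutator of a
  conjugation, of degree 1, with the translation by \<delta>.\<close>

lemma gen_map_right_lower_central:
  assumes i: "i < n" and "\<gamma> \<in> lower_central (free_group i) (Suc (Suc j))"
  shows "gen_map n i \<one>\<^bsub>free_group n\<^esub> \<gamma> \<in> lower_central (IA_plus_group n) (Suc j)"
  using assms(2)
proof (induction j arbitrary: \<gamma>)
  case 0
  have g: "\<gamma> \<in> lower_central (free_group i) 2" using 0 by (simp add: numeral_2_eq_2)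
  then have "\<gamma> \<in> carrier (free_group i)" by (rule FL.N_carrier)
  then show ?case
    using gen_map_IA_plus[OF i one_mem_free_group[OF i], of \<gamma>] g free_group_embed[OF i] by simp
next
  case (Suc j)
  let ?e = "gen_map n i \<one>\<^bsub>free_group n\<^esub>"
  have one: "\<one>\<^bsub>free_group n\<^esub> \<in> carrier (free_group i)" by (rule one_mem_free_group[OF i])
  have comm: "commutator (free_group i) w \<delta> \<in> carrier (free_group i) \<and>
      ?e (commutator (free_group i) w \<delta>) \<in> lower_central (IA_plus_group n) (Suc (Suc j))"
    if w: "w \<in> carrier (free_group i)" and d: "\<delta> \<in> lower_central (free_group i) (Suc (Suc j))" for w \<delta>
  proof -
    have dc: "\<delta> \<in> carrier (free_group i)" using d FL.N_carrier by blast
    let ?c = "gen_map n i (inv\<^bsub>free_group n\<^esub> w) w"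
    have e: "?e \<delta> \<in> lower_central (IA_plus_group n) (Suc j)" using Suc.IH[OF d] .
    have c: "?c \<in> IA_plus n"
      using gen_map_conj_lower_central[OF i, of w 0] w by simp
    have e': "?e \<delta> \<in> IA_plus n" using PL.N_carrier[OF e] by simp
    have "commutator (IA_plus_group n) ?c (?e \<delta>) \<in> lower_central (IA_plus_group n) (Suc (Suc j))"
      using P.commutator_lower_central[OF _ e] c by simp
    moreover have "commutator (IA_plus_group n) ?c (?e \<delta>) = commutator (AutF n) ?c (?e \<delta>)"
      using A.m_inv_consistent[OF subgroup_IA_plus] c e' by (simp add: commutator_def)
    ultimately show ?thesis using commutator_gen_map[OF i w dc] w dc by simp
  qed
  have mult: "?e (u \<otimes>\<^bsub>free_group i\<^esub> v) = ?e u \<otimes>\<^bsub>IA_plus_group n\<^esub> ?e v"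
    if "u \<in> carrier (free_group i)" "v \<in> carrier (free_group i)" for u v
    using that one by (simp add: gen_map_mult[OF i] mult_free_group_eq[of i _ _ n])
  have "\<gamma> \<in> carrier (free_group i) \<and> ?e \<gamma> \<in> lower_central (IA_plus_group n) (Suc (Suc j))"
    using Suc.prems unfolding F.lower_central_Suc_Suc[of i "Suc j"]
  proof induction
    case one
    have "?e \<one>\<^bsub>free_group i\<^esub> = \<one>\<^bsub>IA_plus_group n\<^esub>"
      using gen_map_one[OF i] by (simp add: F.AutoGroup_one free_group_simps(3))
    then show ?case using PL.N_one[of n "Suc (Suc j)"] by simp
  next
    case (incl h)
    then show ?case using comm by blast
  next
    case (inv h)
    then have h: "h \<in> carrier (free_group i)" "?e h \<in> lower_central (IA_plus_group n) (Suc (Suc j))"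
      using comm by blast+
    have "?e (inv\<^bsub>free_group i\<^esub> h) = inv\<^bsub>IA_plus_group n\<^esub> (?e h)"
      using gen_map_inv[OF i one h(1)] A.m_inv_consistent[OF subgroup_IA_plus] PL.N_carrier[OF h(2)] h(1) i
      by (simp add: inv_free_group_mono[of i n])
    then show ?case using PL.N_inv[OF h(2)] h(1) by simp
  next
    case (eng h1 h2)
    then have h: "h1 \<in> carrier (free_group i)" "h2 \<in> carrier (free_group i)"
      "?e h1 \<in> lower_central (IA_plus_group n) (Suc (Suc j))"
      "?e h2 \<in> lower_central (IA_plus_group n) (Suc (Suc j))" by blast+
    show ?case unfolding mult[OF h(1,2)] by (intro conjI F.m_closed PL.N_mult h)
  qed
  then show ?case by simp
qed

lemma retraction_lower_central:
  assumes "m \<le> n" "w \<in> lower_central (free_group n) j"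
  shows "word_eval (free_group m) (fgen m) w \<in> lower_central (free_group m) j"
  using hom_lower_central[OF group_free_group F.lower_central_filtration
      F.word_eval_hom[OF range_fgen[of m m]] assms(2)] by simp

lemma lower_central_IA_plus_le_IA:
  "lower_central (IA_plus_group n) j \<subseteq> lower_central ((AutF n)\<lparr>carrier := IA n\<rparr>) j"
proof
  fix \<phi> assume \<phi>: "\<phi> \<in> lower_central (IA_plus_group n) j"
  interpret IA: group "(AutF n)\<lparr>carrier := IA n\<rparr>" by (rule A.subgroup_imp_group[OF subgroup_IA])
  have "id \<in> hom (IA_plus_group n) ((AutF n)\<lparr>carrier := IA n\<rparr>)"
    using IA_plus_subset_IA[of n] by (auto simp: hom_def)
  from hom_lower_central[OF P.is_group IA.lower_central_filtration this \<phi>]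
  show "\<phi> \<in> lower_central ((AutF n)\<lparr>carrier := IA n\<rparr>) j" by simp
qed

text \<open>Induction on the number \<open>m\<close> of initial generators that may move. The last
  of them is treated first: a product \<kappa> of a conjugation and a translation has the same
  effect on it, and dividing by \<kappa> lowers \<open>m\<close>.\<close>

lemma andreadakis_IA_plus_le:
  assumes j: "1 \<le> j" and "m \<le> n" "\<phi> \<in> IA_plus n" "\<phi> \<in> andreadakis n j"
    and "\<And>i. m \<le> i \<Longrightarrow> i < n \<Longrightarrow> \<phi> (gen i) = gen i"
  shows "\<phi> \<in> lower_central (IA_plus_group n) j"
  using assms(2-)
proof (induction m arbitrary: \<phi>)
  case 0
  have a: "\<phi> \<in> auto (free_group n)" using IA_plus_auto[OF 0(2)] .
  have "\<phi> = (\<lambda>w\<in>carrier (free_group n). w)"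
  proof (rule extensionalityI)
    show "\<phi> \<in> extensional (carrier (free_group n))" using a by (simp add: auto_def Bij_def)
    show "\<phi> w = (\<lambda>w\<in>carrier (free_group n). w) w" if w: "w \<in> carrier (free_group n)" for w
      by (rule free_group_hom_eqI[OF group_free_group auto_hom[OF a] auto_hom[OF F.id_in_auto] _ w])
         (use 0(4) gen_closed in auto)
  qed auto
  then have "\<phi> = \<one>\<^bsub>AutF n\<^esub>" by (simp only: F.AutoGroup_one)
  then show ?case using PL.N_one[of n j] by simp
next
  case (Suc m)
  let ?F = "free_group n" and ?\<Gamma> = "lower_central (free_group n)"
  have m: "m < n" "m \<le> n" using Suc.prems(1) by simp_all
  have a: "\<phi> \<in> auto ?F" using IA_plus_auto[OF Suc.prems(2)] .
  obtain w \<gamma> where w: "w \<in> carrier (free_group m)" and g: "\<gamma> \<in> lower_central (free_group m) 2"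
    and \<phi>m: "\<phi> (gen m) = inv\<^bsub>?F\<^esub> w \<otimes>\<^bsub>?F\<^esub> gen m \<otimes>\<^bsub>?F\<^esub> w \<otimes>\<^bsub>?F\<^esub> \<gamma>"
    using Suc.prems(2) m unfolding IA_plus_iff triangular_image_def by blast
  have gc: "\<gamma> \<in> carrier (free_group m)" using FL.N_carrier[OF g] .
  note c = free_group_embed[OF m(1) w] free_group_embed[OF m(1) gc] gen_closed[OF m(1)]
  have disp: "\<phi> (gen m) \<otimes>\<^bsub>?F\<^esub> inv\<^bsub>?F\<^esub> gen m \<in> ?\<Gamma> (Suc j)"
    using Suc.prems(3) c(3) by (simp add: andreadakis_def)
  \<comment> \<open>The retraction onto F_m kills x_m and fixes w and \<gamma>, so it maps the
    displacement of x_m to \<gamma>.\<close>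
  have \<gamma>: "\<gamma> \<in> lower_central (free_group m) (Suc j)"
  proof -
    let ?r = "word_eval (free_group m) (fgen m)"
    have h: "?r \<in> hom ?F (free_group m)" by (rule F.word_eval_hom[OF range_fgen[of m m]]) simp
    interpret r: group_hom ?F "free_group m" ?r using h by unfold_locales
    have "?r (gen m) = \<one>\<^bsub>free_group m\<^esub>"
      by (simp add: gen_def fgen_def free_group_simps reduce_def)
    then have "?r (\<phi> (gen m) \<otimes>\<^bsub>?F\<^esub> inv\<^bsub>?F\<^esub> gen m) = \<gamma>"
      unfolding \<phi>m using c w gc word_eval_fgen[OF w] word_eval_fgen[OF gc] F.word_simps[of _ m]
      by simp
    then show ?thesis using retraction_lower_central[OF m(2) disp] by simp
  qed
  have w\<Gamma>: "w \<in> lower_central (free_group m) j"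
  proof -
    \<comment> \<open>Multiplying by a conjugate of \<gamma>^-1 removes \<gamma> from the
      displacement and leaves [w^-1, x_m].\<close>
    have "\<phi> (gen m) \<otimes>\<^bsub>?F\<^esub> inv\<^bsub>?F\<^esub> gen m \<otimes>\<^bsub>?F\<^esub> (gen m \<otimes>\<^bsub>?F\<^esub> inv\<^bsub>?F\<^esub> \<gamma> \<otimes>\<^bsub>?F\<^esub> inv\<^bsub>?F\<^esub> gen m) \<in> ?\<Gamma> (Suc j)"
      by (rule FL.N_mult[OF disp FL.N_conj[OF c(3) FL.N_inv[OF lower_central_free_group_mono[OF m(2) \<gamma>]]]])
    also have "\<phi> (gen m) \<otimes>\<^bsub>?F\<^esub> inv\<^bsub>?F\<^esub> gen m \<otimes>\<^bsub>?F\<^esub> (gen m \<otimes>\<^bsub>?F\<^esub> inv\<^bsub>?F\<^esub> \<gamma> \<otimes>\<^bsub>?F\<^esub> inv\<^bsub>?F\<^esub> gen m)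
      = commutator ?F (inv\<^bsub>?F\<^esub> w) (gen m)"
      unfolding \<phi>m commutator_def using c by (simp add: F.word_simps)
    finally have "inv\<^bsub>?F\<^esub> w \<in> lower_central (free_group m) j"
      by (rule lower_central_of_commutator_gen[OF m(1) inv_mem_free_group[OF m(1) w]])
    then have "inv\<^bsub>free_group m\<^esub> (inv\<^bsub>free_group m\<^esub> w) \<in> lower_central (free_group m) j"
      using FL.N_inv inv_free_group_mono[OF m(2) w] by simp
    then show ?thesis using w by simp
  qed
  define \<kappa> where "\<kappa> = gen_map n m (inv\<^bsub>?F\<^esub> w) w \<otimes>\<^bsub>AutF n\<^esub> gen_map n m \<one>\<^bsub>?F\<^esub> \<gamma>"
  have \<kappa>_eq: "\<kappa> = gen_map n m (inv\<^bsub>?F\<^esub> w) (w \<otimes>\<^bsub>?F\<^esub> \<gamma>)"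
    unfolding \<kappa>_def using w gc inv_mem_free_group[OF m(1)] one_mem_free_group[OF m(1)] c by (simp add: gen_map_mult[OF m(1)])
  have wg: "w \<otimes>\<^bsub>?F\<^esub> \<gamma> \<in> carrier (free_group m)"
    using F.m_closed[OF w gc] by (simp add: mult_free_group_eq[of m _ _ n])
  have "gen_map n m \<one>\<^bsub>?F\<^esub> \<gamma> \<in> lower_central (IA_plus_group n) j"
    using gen_map_right_lower_central[OF m(1), of \<gamma> "j - 1"] \<gamma> j by simp
  then have \<kappa>: "\<kappa> \<in> lower_central (IA_plus_group n) j"
    using PL.N_mult[OF gen_map_conj_lower_central[OF m(1) w\<Gamma>]] unfolding \<kappa>_def by simp
  have \<kappa>P: "\<kappa> \<in> IA_plus n" using PL.N_carrier[OF \<kappa>] by simp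
  have \<kappa>A: "\<kappa> \<in> andreadakis n j"
    using \<kappa> lower_central_IA_plus_le_IA lower_central_IA_le[OF j] by blast
  define \<psi> where "\<psi> = inv\<^bsub>AutF n\<^esub> \<kappa> \<otimes>\<^bsub>AutF n\<^esub> \<phi>"
  have \<kappa>a: "\<kappa> \<in> auto ?F" "inv\<^bsub>AutF n\<^esub> \<kappa> \<in> auto ?F"
    using IA_plus_auto[OF \<kappa>P] IA_plus_auto[OF IA_plus_inv[OF \<kappa>P]] by auto
  have \<psi>P: "\<psi> \<in> IA_plus n"
    unfolding \<psi>_def by (rule IA_plus_mult[OF IA_plus_inv[OF \<kappa>P] Suc.prems(2)])
  have \<psi>A: "\<psi> \<in> andreadakis n j"
    unfolding \<psi>_def using subgroup_andreadakis[OF j] \<kappa>A Suc.prems(3)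
    by (meson subgroup.m_closed subgroup.m_inv_closed)
  have \<psi>_apply: "\<psi> (gen k) = (inv\<^bsub>AutF n\<^esub> \<kappa>) (\<phi> (gen k))" if "k < n" for k
    using gen_closed[OF that] \<kappa>a a by (simp add: \<psi>_def F.AutoGroup_mult compose_def)
  have "\<psi> \<in> lower_central (IA_plus_group n) j"
  proof (rule Suc.IH[OF m(2) \<psi>P \<psi>A])
    fix k assume k: "m \<le> k" "k < n"
    \<comment> \<open>Agreement on all generators from x_m on makes \<kappa>^-1 \<phi> fix them, as
      the induction hypothesis requires.\<close>
    have "\<phi> (gen k) = \<kappa> (gen k)"
    proof (cases "k = m")
      case True
      then show ?thesis
        unfolding \<kappa>_eq gen_map_gen[OF m(1) inv_mem_free_group[OF m(1) w] wg k(2)] using \<phi>m c by (simp add: F.m_assoc)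
    next
      case False
      then show ?thesis
        unfolding \<kappa>_eq gen_map_gen[OF m(1) inv_mem_free_group[OF m(1) w] wg k(2)] using Suc.prems(4) k by simp
    qed
    then show "\<psi> (gen k) = gen k"
      using \<psi>_apply[OF k(2)] F.auto_inverse_apply(2)[OF \<kappa>a(1) gen_closed[OF k(2)]] by simp
  qed
  then have "\<kappa> \<otimes>\<^bsub>IA_plus_group n\<^esub> \<psi> \<in> lower_central (IA_plus_group n) j"
    by (rule PL.N_mult[OF \<kappa>])
  moreover have "\<kappa> \<otimes>\<^bsub>AutF n\<^esub> \<psi> = \<phi>"
    unfolding \<psi>_def using \<kappa>a(1) a A.inv_mult_cancel(2)[of \<kappa> n \<phi>] by simp
  ultimately show ?case by simp
qed

theorem mainTheorem9:
  fixes n j :: nat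
  assumes "n \<ge> 1" and "j \<ge> 1"
  shows "lower_central ((AutF n)\<lparr>carrier := IA_plus n\<rparr>) j
           = lower_central ((AutF n)\<lparr>carrier := IA n\<rparr>) j \<inter> IA_plus n
       \<and> lower_central ((AutF n)\<lparr>carrier := IA n\<rparr>) j \<inter> IA_plus n
           = andreadakis n j \<inter> IA_plus n"
proof -
  have 1: "lower_central (IA_plus_group n) j \<subseteq> IA_plus n"
  proof
    fix \<phi> assume "\<phi> \<in> lower_central (IA_plus_group n) j"
    from PL.N_carrier[OF this] show "\<phi> \<in> IA_plus n" by simp
  qed
  have 2: "andreadakis n j \<inter> IA_plus n \<subseteq> lower_central (IA_plus_group n) j"
  proof
    fix \<phi> assume "\<phi> \<in> andreadakis n j \<inter> IA_plus n"
    then have "\<phi> \<in> IA_plus n" "\<phi> \<in> andreadakis n j" by simp_all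
    \<comment> \<open>Taken with \<open>m\<close> equal to \<open>n\<close>, so that the condition
      on fixed generators is vacuous.\<close>
    from andreadakis_IA_plus_le[OF assms(2) order_refl this]
    show "\<phi> \<in> lower_central (IA_plus_group n) j" by simp
  qed
  show ?thesis
    using 1 2 lower_central_IA_plus_le_IA[of n j] lower_central_IA_le[OF assms(2), of n] by blast
qed

end
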